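(* Let $(V,\pi)$ be a ramified discrete valuation ring of mixed characteristic $(0,p)$ with uniformizer $\pi$. Set $S=V[x_1,\ldots,x_n]$ and $\overline S=S/\pi S$. Then there exists a $\mathbb Z$-derivation $\frac{\partial}{\partial\pi}:S\to\overline S$ such that $\frac{\partial}{\partial\pi}(\pi)=1$.
   Context: A ramified discrete valuation ring of mixed characteristic $(0,p)$ with uniformizer $\pi$ is a discrete valuation ring $V$ of characteristic $0$ with maximal ideal $(\pi)$, whose residue field $V/\pi V$ has characteristic $p>0$, and such that $p\in(\pi)^2$. A $\mathbb Z$-derivation from $S$ to an $S$-module $M$ is an additive map $d:S\to M$ with $d(rs)=r\,d(s)+s\,d(r)$ for all $r,s\in S$. *)

theory Defs
  imports "HOL-Algebra.Algebra"
begin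

text \<open>\<open>group.ord\<close> is \<open>0\<close> on elements of infinite order, as required in characteristic zero.\<close>

definition ring_char :: "('a, 'b) ring_scheme \<Rightarrow> nat"
  where "ring_char R = group.ord (add_monoid R) \<one>\<^bsub>R\<^esub>"

locale discrete_valuation_ring = principal_domain R for R (structure) +
  assumes ex1_maximalideal: "\<exists>!M. maximalideal M R"
    and not_field: "\<not> field R"

locale ramified_dvr = discrete_valuation_ring V for V (structure) +
  fixes \<pi> :: 'a and p :: nat
  assumes uniformizer_closed: "\<pi> \<in> carrier V"
    and maximalideal_uniformizer: "maximalideal (PIdl \<pi>) V"
    and ring_char_zero: "ring_char V = 0"
    and ring_char_residue_field: "ring_char (V Quot (PIdl \<pi>)) = p"
    and residue_char_pos: "p > 0"
    and ramified: "[p] \<cdot> \<one> \<in> (PIdl \<pi>) \<cdot> (PIdl \<pi>)"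

text \<open>
  The polynomial ring $R[x_1,\ldots,x_n]$, in the representation of
  \<^theory>\<open>HOL-Algebra.Indexed_Polynomials\<close>: a polynomial maps each monomial, a multiset of
  variable indices, to its coefficient, so the factorizations of a monomial \<open>m\<close> are the pairs
  \<open>(a, m - a)\<close> with \<open>a \<subseteq># m\<close>.
\<close>

definition mpoly_ring :: "('a, 'b) ring_scheme \<Rightarrow> nat \<Rightarrow> (nat multiset \<Rightarrow> 'a) ring"
  where "mpoly_ring R n =
    \<lparr> carrier = ring.indexed_pset R {1..n} (carrier R),
      monoid.mult = (\<lambda>P Q m. \<Oplus>\<^bsub>R\<^esub>a\<in>{a. a \<subseteq># m}. P a \<otimes>\<^bsub>R\<^esub> Q (m - a)),
      one = ring.indexed_const R \<one>\<^bsub>R\<^esub>,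
      ring.zero = ring.indexed_const R \<zero>\<^bsub>R\<^esub>,
      add = ring.indexed_padd R \<rparr>"

definition quot_module :: "('a, 'b) ring_scheme \<Rightarrow> 'a set \<Rightarrow> ('a, 'a set) module"
  where "quot_module R I =
    ring.extend (R Quot I) \<lparr> smult = (\<lambda>r x. (I +>\<^bsub>R\<^esub> r) \<otimes>\<^bsub>R Quot I\<^esub> x) \<rparr>"

locale Z_derivation = module R M for R (structure) and M (structure) +
  fixes d :: "'a \<Rightarrow> 'c"
  assumes d_closed: "d \<in> carrier R \<rightarrow> carrier M"
    and d_add: "\<lbrakk> r \<in> carrier R; s \<in> carrier R \<rbrakk> \<Longrightarrow> d (r \<oplus> s) = d r \<oplus>\<^bsub>M\<^esub> d s"
    and d_mult: "\<lbrakk> r \<in> carrier R; s \<in> carrier R \<rbrakk> \<Longrightarrow>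
      d (r \<otimes> s) = r \<odot>\<^bsub>M\<^esub> d s \<oplus>\<^bsub>M\<^esub> s \<odot>\<^bsub>M\<^esub> d r"

end

theory Submission
  imports Defs
begin

text \<open>
  It suffices to find \<open>\<delta> : V \<rightarrow> V\<close> that is a derivation modulo \<open>\<pi>\<close> with
  \<open>\<delta> \<pi> \<equiv> 1\<close>, since it can then be applied coefficientwise to polynomials.
  As \<open>p \<in> (\<pi>\<^sup>2)\<close>, the ring \<open>V/\<pi>\<^sup>2\<close> has characteristic \<open>p\<close>, and a coefficient field
  of it gives a decomposition \<open>v = b + \<pi> w\<close>, from which \<open>\<delta> v = w\<close> modulo \<open>\<pi>\<close>.
  The preimage in \<open>V\<close> of a coefficient field is a subring \<open>B\<close>, maximal among those containing
  \<open>\<pi>\<^sup>2 V\<close> and all \<open>p\<close>-th powers and satisfying \<open>B \<inter> \<pi> V \<subseteq> \<pi>\<^sup>2 V\<close>. The smallest candidate is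
  \<open>{v\<^sup>p + \<pi>\<^sup>2 w}\<close>. To see that a maximal \<open>B\<close> meets every residue class of \<open>a \<in> V\<close>, take a monic
  relation for \<open>a\<close> over \<open>B\<close> modulo \<open>\<pi>\<close> of minimal degree \<open>d \<le> p\<close>. If \<open>d = p\<close>, then
  \<open>a\<^sup>p \<in> B\<close>; otherwise a Newton step replaces \<open>a\<close> by a congruent element that satisfies the
  relation modulo \<open>\<pi>\<^sup>2\<close>. In both cases \<open>B + B a + \<dots> + B a\<^bsup>d-1\<^esup>\<close> is again a
  candidate.
\<close>

hide_const (open) Divisibility.prime
no_notation ideal_prod (infixl \<open>\<cdot>\<index>\<close> 80)

section \<open>Binomial expansion and polynomial values in commutative rings\<close>

lemma (in cring) binomial_expansion:
  assumes x: "x \<in> carrier R" and y: "y \<in> carrier R"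
  shows "(x \<oplus> y) [^] (n::nat) = (\<Oplus>i\<in>{..n}. [(n choose i)] \<cdot> (x [^] i \<otimes> y [^] (n - i)))"
proof (induction n)
  case 0
  then show ?case using x y by simp
next
  case (Suc n)
  \<comment> \<open>The index \<open>k\<close> of the binomial coefficient is kept apart from the
    exponent \<open>i\<close>: multiplication by \<open>x\<close> raises only the exponent and
    yields \<open>f i (Suc i)\<close>, multiplication by \<open>y\<close> yields
    \<open>f i i\<close>. Pascal's rule then joins \<open>f i (Suc i)\<close> with
    \<open>f (Suc i) (Suc i)\<close>.\<close>
  define f where "f k i = [(n choose k)] \<cdot> (x [^] i \<otimes> y [^] (Suc n - i))" for k i
  have f: "f k i \<in> carrier R" for k i
    using x y by (simp add: f_def)
  let ?s = "\<Oplus>i\<in>{..n}. [(n choose i)] \<cdot> (x [^] i \<otimes> y [^] (n - i))"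
  have s: "?s \<in> carrier R" using x y by (intro finsum_closed) auto
  have "?s \<otimes> x = (\<Oplus>i\<in>{..n}. f i (Suc i))"
    using x y by (subst finsum_ldistr)
      (auto intro!: finsum_cong' simp: f_def add_pow_ldistr add_pow_rdistr m_ac)
  moreover have "?s \<otimes> y = (\<Oplus>i\<in>{..n}. f i i)"
    using x y by (subst finsum_ldistr)
      (auto intro!: finsum_cong' simp: f_def add_pow_ldistr add_pow_rdistr m_ac Suc_diff_le)
  moreover have "(\<Oplus>i\<in>{..n}. f i i) = (\<Oplus>i\<in>{..n}. f (Suc i) (Suc i)) \<oplus> f 0 0"
  proof -
    \<comment> \<open>The added last term vanishes because \<open>n choose Suc n\<close> is zero;
      with it present, splitting off the first term reindexes the sum over the same range.\<close>
    have "(\<Oplus>i\<in>{..Suc n}. f i i) = (\<Oplus>i\<in>{..n}. f i i)"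
      using f x y by (subst finsum_Suc) (auto simp: f_def binomial_eq_0)
    then show ?thesis using f by (subst (asm) finsum_Suc2) auto
  qed
  moreover have "(\<Oplus>i\<in>{..n}. f i (Suc i)) \<oplus> (\<Oplus>i\<in>{..n}. f (Suc i) (Suc i))
      = (\<Oplus>i\<in>{..n}. [(Suc n choose Suc i)] \<cdot> (x [^] Suc i \<otimes> y [^] (Suc n - Suc i)))"
    using f x y by (subst finsum_addf[symmetric])
      (auto intro!: finsum_cong' simp: f_def add.nat_pow_mult)
  ultimately show ?case
    using x y f s Suc
    by (subst finsum_Suc2) (auto simp: r_distr f_def a_assoc[symmetric] finsum_closed)
qed

lemma (in ideal) finsum_mem:
  assumes "finite A" "\<And>i. i \<in> A \<Longrightarrow> f i \<in> I"
  shows "finsum R f A \<in> I"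
  using assms
proof (induction A rule: finite_induct)
  case (insert x F)
  then have "f ` insert x F \<subseteq> carrier R" using a_subset by auto
  then show ?case using insert by (subst finsum_insert) (auto intro: a_closed)
qed simp

text \<open>The prime divides every inner binomial coefficient, so all terms but the two outer ones
  are multiples of \<open>[p] \<cdot> \<one>\<close>. The ideal is kept general; the later use is
  modulo the square of the uniformizer.\<close>

lemma (in cring) freshmans_dream:
  assumes "ideal I R" "prime (p::nat)" "[p] \<cdot> \<one> \<in> I" and x: "x \<in> carrier R" and y: "y \<in> carrier R"
  shows "\<exists>z\<in>I. (x \<oplus> y) [^] p = x [^] p \<oplus> y [^] p \<oplus> z"
proof -
  interpret ideal I R by fact
  define f where "f i = [(p choose i)] \<cdot> (x [^] i \<otimes> y [^] (p - i))" for i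
  have f: "f i \<in> carrier R" for i
    using x y by (simp add: f_def)
  \<comment> \<open>With \<open>p\<close> written this way the inner indices are exactly
    \<open>Suc i\<close> for \<open>i \<le> q\<close>.\<close>
  obtain q where q: "p = Suc (Suc q)"
    using prime_ge_2_nat[OF \<open>prime p\<close>] by (metis add_2_eq_Suc le_Suc_ex)
  have "f (Suc i) \<in> I" if "i \<le> q" for i
  proof -
    have "p dvd (p choose Suc i)"
      using that q \<open>prime p\<close> by (intro dvd_choose_prime) auto
    then obtain k where "p choose Suc i = p * k" by blast
    then have "f (Suc i) = [p] \<cdot> \<one> \<otimes> ([k] \<cdot> (x [^] Suc i \<otimes> y [^] (p - Suc i)))"
      using x y by (simp add: f_def add_pow_ldistr add.nat_pow_pow mult.commute)
    then show ?thesis using assms x y by (simp add: I_r_closed)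
  qed
  then have "(\<Oplus>i\<in>{..q}. f (Suc i)) \<in> I" by (intro finsum_mem) auto
  moreover have "(x \<oplus> y) [^] p = (\<Oplus>i\<in>{..p}. f i)"
    using binomial_expansion[OF x y] by (simp add: f_def)
  moreover have "(\<Oplus>i\<in>{..p}. f i) = f p \<oplus> ((\<Oplus>i\<in>{..q}. f (Suc i)) \<oplus> f 0)"
    using finsum_Suc[of f "Suc q"] finsum_Suc2[of f q] f q by simp
  moreover have "f p = x [^] p" "f 0 = y [^] p" using x y by (auto simp: f_def)
  moreover have "a \<oplus> (b \<oplus> c) = a \<oplus> c \<oplus> b" if "a \<in> carrier R" "b \<in> I" "c \<in> carrier R" for a b c
    using that a_subset by (simp add: a_ac)
  ultimately show ?thesis using x y by auto
qed

section \<open>Values of polynomials in one variable and their Taylor expansion\<close>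

context ring
begin

primrec peval :: "(nat \<Rightarrow> 'a) \<Rightarrow> nat \<Rightarrow> 'a \<Rightarrow> 'a" where
  "peval c 0 x = \<zero>"
| "peval c (Suc n) x = peval c n x \<oplus> c n \<otimes> x [^] n"

text \<open>This is the \<open>B\<close>-module generated by the powers of \<open>x\<close> with
  exponents below \<open>n\<close>. Entries of \<open>c\<close> from index \<open>n\<close> on do
  not affect the value, so a total function can encode the coefficients.\<close>

definition pspan :: "'a set \<Rightarrow> nat \<Rightarrow> 'a \<Rightarrow> 'a set" where
  "pspan B n x = {peval c n x |c. range c \<subseteq> B}"

lemma peval_closed [simp, intro]:
  "range c \<subseteq> carrier R \<Longrightarrow> x \<in> carrier R \<Longrightarrow> peval c n x \<in> carrier R"
proof (induction n)
  case (Suc n)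
  then have "c n \<in> carrier R" by auto
  with Suc show ?case by simp
qed simp

end

context cring
begin

lemma peval_add:
  assumes "range c \<subseteq> carrier R" "range c' \<subseteq> carrier R" "x \<in> carrier R"
  shows "peval (\<lambda>i. c i \<oplus> c' i) n x = peval c n x \<oplus> peval c' n x"
proof (induction n)
  case (Suc n)
  have "c n \<in> carrier R" "c' n \<in> carrier R" using assms by auto
  with Suc assms show ?case by (simp add: l_distr a_ac)
qed simp

lemma peval_smult:
  assumes "range c \<subseteq> carrier R" "b \<in> carrier R" "x \<in> carrier R"
  shows "peval (\<lambda>i. b \<otimes> c i) n x = b \<otimes> peval c n x"
proof (induction n)
  case (Suc n)
  have "c n \<in> carrier R" using assms by auto
  with Suc assms show ?case by (simp add: r_distr m_assoc)
qed (use assms in simp)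

lemma peval_const:
  assumes "b \<in> carrier R" "x \<in> carrier R" "n > 0"
  shows "peval (\<lambda>i. if i = 0 then b else \<zero>) n x = b"
proof -
  have "peval (\<lambda>i. if i = 0 then b else \<zero>) (Suc m) x = b" for m
    by (induction m) (use assms in auto)
  with assms show ?thesis by (cases n) auto
qed

lemma peval_shift:
  assumes "range c \<subseteq> carrier R" "x \<in> carrier R"
  shows "peval (\<lambda>i. case i of 0 \<Rightarrow> \<zero> | Suc j \<Rightarrow> c j) (Suc n) x = peval c n x \<otimes> x"
proof (induction n)
  case (Suc n)
  have "c n \<in> carrier R" using assms by auto
  with Suc assms show ?case by (simp add: l_distr m_assoc)
qed (use assms in simp)

text \<open>Only divisibility of the remainder by \<open>w \<otimes> w\<close> matters: for
  \<open>w\<close> in the maximal ideal the remainder then dies modulo the square of the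
  uniformizer.\<close>

lemma power_taylor:
  assumes "x \<in> carrier R" "w \<in> carrier R"
  shows "\<exists>z\<in>carrier R. (x \<oplus> w) [^] Suc n
    = x [^] Suc n \<oplus> w \<otimes> ([Suc n] \<cdot> (x [^] n)) \<oplus> w \<otimes> w \<otimes> z"
proof (induction n)
  case 0
  then show ?case using assms by (intro bexI[of _ \<zero>]) auto
next
  case (Suc n)
  then obtain z where z: "z \<in> carrier R" "(x \<oplus> w) [^] Suc n
    = x [^] Suc n \<oplus> w \<otimes> ([Suc n] \<cdot> (x [^] n)) \<oplus> w \<otimes> w \<otimes> z" by blast
  define T where "T = x [^] n"
  \<comment> \<open>Writing the multiple \<open>[Suc n] \<cdot> y\<close> as a product with
    \<open>k\<close> makes the identity below one between ring elements, within reach of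
    \<open>algebra\<close>.\<close>
  define k where "k = [Suc n] \<cdot> \<one>"
  have T: "T \<in> carrier R" "k \<in> carrier R" using assms by (auto simp: T_def k_def)
  have kT: "[Suc n] \<cdot> y = k \<otimes> y" if "y \<in> carrier R" for y
    using that by (simp add: k_def add_pow_ldistr del: add.nat_pow_Suc)
  have "(x \<oplus> w) [^] Suc (Suc n) = (T \<otimes> x \<oplus> w \<otimes> (k \<otimes> T) \<oplus> w \<otimes> w \<otimes> z) \<otimes> (x \<oplus> w)"
    using z(2) kT[of T] T unfolding T_def by (simp only: nat_pow_Suc)
  also have "\<dots> = T \<otimes> x \<otimes> x \<oplus> w \<otimes> (k \<otimes> (T \<otimes> x) \<oplus> T \<otimes> x) \<oplus> w \<otimes> w \<otimes> (k \<otimes> T \<oplus> z \<otimes> (x \<oplus> w))"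
    using assms T z(1) by algebra
  also have "k \<otimes> (T \<otimes> x) \<oplus> T \<otimes> x = [Suc (Suc n)] \<cdot> (x [^] Suc n)"
    using assms T by (subst add.nat_pow_Suc, subst kT) (auto simp: T_def)
  also have "T \<otimes> x \<otimes> x = x [^] Suc (Suc n)" by (simp add: T_def)
  finally show ?case using assms T z by blast
qed

text \<open>The linear coefficient is the value of the formal derivative, which has one term fewer
  than the polynomial. This is the expansion behind the Newton step.\<close>

lemma peval_taylor:
  assumes c: "range c \<subseteq> carrier R" and "x \<in> carrier R" "w \<in> carrier R"
  shows "\<exists>z\<in>carrier R. peval c (Suc n) (x \<oplus> w) = peval c (Suc n) x
    \<oplus> w \<otimes> peval (\<lambda>i. [Suc i] \<cdot> c (Suc i)) n x \<oplus> w \<otimes> w \<otimes> z"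
proof (induction n)
  case 0
  have "c 0 \<in> carrier R" using c by auto
  then show ?case using assms by (intro bexI[of _ \<zero>]) auto
next
  case (Suc n)
  define P where "P = peval c (Suc n) x"
  define D where "D = peval (\<lambda>i. [Suc i] \<cdot> c (Suc i)) n x"
  obtain z where z: "z \<in> carrier R"
    "peval c (Suc n) (x \<oplus> w) = P \<oplus> w \<otimes> D \<oplus> w \<otimes> w \<otimes> z" using Suc unfolding P_def D_def by blast
  obtain z' where z': "z' \<in> carrier R" "(x \<oplus> w) [^] Suc n
      = x [^] Suc n \<oplus> w \<otimes> ([Suc n] \<cdot> (x [^] n)) \<oplus> w \<otimes> w \<otimes> z'"
    using power_taylor assms by blast
  define Y where "Y = x [^] Suc n"
  define T where "T = [Suc n] \<cdot> (x [^] n)"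
  define C where "C = c (Suc n)"
  have cl: "P \<in> carrier R" "D \<in> carrier R" "C \<in> carrier R" "T \<in> carrier R" "Y \<in> carrier R"
    using assms unfolding C_def T_def Y_def P_def D_def
    by (auto simp del: add.nat_pow_Suc nat_pow_Suc peval.simps intro!: peval_closed)
  have CT: "[Suc n] \<cdot> C \<otimes> x [^] n = C \<otimes> T"
    using assms cl unfolding T_def by (simp only: add_pow_ldistr add_pow_rdistr nat_pow_closed)
  have "peval c (Suc (Suc n)) (x \<oplus> w)
      = (P \<oplus> w \<otimes> D \<oplus> w \<otimes> w \<otimes> z) \<oplus> C \<otimes> (Y \<oplus> w \<otimes> T \<oplus> w \<otimes> w \<otimes> z')"
    unfolding peval.simps(2)[of c "Suc n"] z(2) z'(2) C_def T_def Y_def by (rule refl)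
  also have "\<dots> = (P \<oplus> C \<otimes> Y) \<oplus> w \<otimes> (D \<oplus> C \<otimes> T) \<oplus> w \<otimes> w \<otimes> (z \<oplus> C \<otimes> z')"
    using cl z(1) z'(1) assms by algebra
  also have "P \<oplus> C \<otimes> Y = peval c (Suc (Suc n)) x"
    unfolding peval.simps(2)[of c "Suc n"] C_def Y_def P_def by (rule refl)
  also have "D \<oplus> C \<otimes> T = peval (\<lambda>i. [Suc i] \<cdot> c (Suc i)) (Suc n) x"
    using CT by (simp only: peval.simps(2) C_def D_def)
  finally show ?case using cl z z' by blast
qed

end

section \<open>Adjoining one element to a subring; congruences modulo an ideal\<close>

context cring
begin

context
  fixes B x
  assumes B: "subring B R" and x: "x \<in> carrier R"
begin

lemma range_subring_carrier: "range c \<subseteq> B \<Longrightarrow> range c \<subseteq> carrier R"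
  using subringE(1)[OF B] by auto

lemma pspan_subset: "pspan B n x \<subseteq> carrier R"
  unfolding pspan_def using range_subring_carrier x by auto

lemma pspan_add: "y \<in> pspan B n x \<Longrightarrow> y' \<in> pspan B n x \<Longrightarrow> y \<oplus> y' \<in> pspan B n x"
proof -
  assume "y \<in> pspan B n x" "y' \<in> pspan B n x"
  then obtain c c' where c: "range c \<subseteq> B" "range c' \<subseteq> B" "y = peval c n x" "y' = peval c' n x"
    unfolding pspan_def by blast
  then have "y \<oplus> y' = peval (\<lambda>i. c i \<oplus> c' i) n x"
    using peval_add[OF range_subring_carrier range_subring_carrier x] by simp
  moreover have "range (\<lambda>i. c i \<oplus> c' i) \<subseteq> B"
    using c subringE(7)[OF B] by (auto simp: image_subset_iff)
  ultimately show ?thesis unfolding pspan_def by blast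
qed

lemma pspan_smult: "b \<in> B \<Longrightarrow> y \<in> pspan B n x \<Longrightarrow> b \<otimes> y \<in> pspan B n x"
proof -
  assume b: "b \<in> B" and "y \<in> pspan B n x"
  then obtain c where c: "range c \<subseteq> B" "y = peval c n x"
    unfolding pspan_def by blast
  then have "b \<otimes> y = peval (\<lambda>i. b \<otimes> c i) n x"
    using x b subringE(1)[OF B] range_subring_carrier by (subst peval_smult) auto
  moreover have "range (\<lambda>i. b \<otimes> c i) \<subseteq> B"
    using b c subringE(6)[OF B] by (auto simp: image_subset_iff)
  ultimately show ?thesis unfolding pspan_def by blast
qed

lemma pspan_minus: "y \<in> pspan B n x \<Longrightarrow> \<ominus> y \<in> pspan B n x"
  using pspan_smult[of "\<ominus> \<one>" y n] subringE(3,5)[OF B] pspan_subset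
  by (metis l_minus l_one one_closed subsetD)

lemma pspan_const: "n > 0 \<Longrightarrow> b \<in> B \<Longrightarrow> b \<in> pspan B n x"
proof -
  assume "n > 0" "b \<in> B"
  then have "b = peval (\<lambda>i. if i = 0 then b else \<zero>) n x"
    using x subringE(1)[OF B] by (subst peval_const) auto
  moreover have "range (\<lambda>i::nat. if i = 0 then b else \<zero>) \<subseteq> B"
    using \<open>b \<in> B\<close> subringE(2)[OF B] by auto
  ultimately show ?thesis unfolding pspan_def by blast
qed

text \<open>The first hypothesis is a monic equation of degree \<open>n\<close> for \<open>x\<close>
  over \<open>B\<close>. Multiplying by \<open>x\<close> shifts the coefficients, and this equation
  rewrites the one term of exponent \<open>n\<close> that leaves the range.\<close>

lemma pspan_mult_var:
  assumes xd: "x [^] n \<in> pspan B n x" and "y \<in> pspan B n x"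
  shows "y \<otimes> x \<in> pspan B n x"
proof -
  obtain c where c: "range c \<subseteq> B" "y = peval c n x"
    using assms unfolding pspan_def by blast
  define s where "s = (\<lambda>i. case i of 0 \<Rightarrow> \<zero> | Suc j \<Rightarrow> c j)"
  have s: "range s \<subseteq> B"
    using c subringE(2)[OF B] by (auto simp: s_def image_subset_iff split: nat.split)
  have "y \<otimes> x = peval s n x \<oplus> s n \<otimes> x [^] n"
    using peval_shift[OF range_subring_carrier[OF c(1)] x, of n, folded s_def] c(2) by simp
  moreover have "peval s n x \<in> pspan B n x" using s unfolding pspan_def by blast
  moreover have "s n \<otimes> x [^] n \<in> pspan B n x" using s xd pspan_smult by blast
  ultimately show ?thesis using pspan_add by metis
qed

text \<open>The usual argument for integral elements: stability under multiplication by
  \<open>x\<close> gives stability under all its powers, and then under their combinations over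
  \<open>B\<close>. The span is thus the ring obtained by adjoining \<open>x\<close> to
  \<open>B\<close>.\<close>

lemma subring_pspan:
  assumes "n > 0" and xd: "x [^] n \<in> pspan B n x"
  shows "subring (pspan B n x) R"
proof (rule subringI)
  show "pspan B n x \<subseteq> carrier R" by (rule pspan_subset)
  show "\<one> \<in> pspan B n x" using pspan_const assms subringE(3)[OF B] by blast
  fix y y' assume y: "y \<in> pspan B n x" and y': "y' \<in> pspan B n x"
  show "\<ominus> y \<in> pspan B n x" using pspan_minus y by blast
  show "y \<oplus> y' \<in> pspan B n x" using pspan_add y y' by blast
  have yc: "y \<in> carrier R" using y pspan_subset by blast
  have pow: "y \<otimes> x [^] i \<in> pspan B n x" for i :: nat
  proof (induction i)
    case (Suc i)
    then show ?case using pspan_mult_var[OF xd Suc] x yc by (simp add: m_assoc)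
  qed (use y yc in simp)
  obtain c where c: "range c \<subseteq> B" "y' = peval c n x" using y' unfolding pspan_def by blast
  have "y \<otimes> peval c m x \<in> pspan B n x" for m
  proof (induction m)
    case 0
    then show ?case using yc pspan_const[OF \<open>n > 0\<close>] subringE(2)[OF B] by simp
  next
    case (Suc m)
    have cm: "c m \<in> B" "c m \<in> carrier R" using c subringE(1)[OF B] by auto
    have "peval c m x \<in> carrier R" using c x range_subring_carrier by blast
    then have "y \<otimes> peval c (Suc m) x = y \<otimes> peval c m x \<oplus> c m \<otimes> (y \<otimes> x [^] m)"
      using x yc cm by (simp add: r_distr m_ac)
    then show ?case using pspan_add[OF Suc pspan_smult[OF cm(1) pow]] by simp
  qed
  then show "y \<otimes> y' \<in> pspan B n x" using c by simp
qed

end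

lemma (in ideal) mem_minus: "a \<in> I \<Longrightarrow> b \<in> I \<Longrightarrow> a \<ominus> b \<in> I"
  by (simp add: a_minus_def a_closed a_inv_closed)

lemma (in ideal) peval_mem:
  assumes "\<And>i. i < n \<Longrightarrow> c i \<in> I" "x \<in> carrier R"
  shows "peval c n x \<in> I"
  using assms by (induction n) (auto intro!: a_closed I_r_closed)

lemma ideal_mult_cong:
  assumes "ideal I R" "x \<ominus> x' \<in> I" "y \<ominus> y' \<in> I"
    "x \<in> carrier R" "x' \<in> carrier R" "y \<in> carrier R" "y' \<in> carrier R"
  shows "x \<otimes> y \<ominus> x' \<otimes> y' \<in> I"
proof -
  interpret ideal I R by fact
  have "x \<otimes> y \<ominus> x' \<otimes> y' = (x \<ominus> x') \<otimes> y \<oplus> x' \<otimes> (y \<ominus> y')"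
    using assms(4-) by algebra
  then show ?thesis using assms by (simp add: I_r_closed I_l_closed a_closed)
qed

lemma ideal_pow_cong:
  assumes "ideal I R" "x \<ominus> y \<in> I" "x \<in> carrier R" "y \<in> carrier R"
  shows "x [^] (n::nat) \<ominus> y [^] n \<in> I"
proof (induction n)
  case 0
  then show ?case using ideal.axioms(1)[OF assms(1)]
    by (simp add: r_neg minus_eq additive_subgroup.zero_closed)
qed (use assms ideal_mult_cong in simp)

lemma ideal_peval_cong:
  assumes "ideal I R" "x \<ominus> y \<in> I" "x \<in> carrier R" "y \<in> carrier R" "range c \<subseteq> carrier R"
  shows "peval c n x \<ominus> peval c n y \<in> I"
proof -
  interpret ideal I R by fact
  show ?thesis
  proof (induction n)
    case 0
    then show ?case by (simp add: r_neg minus_eq)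
  next
    case (Suc n)
    define P where "P = peval c n x"
    define Q where "Q = peval c n y"
    define u where "u = x [^] n"
    define v where "v = y [^] n"
    define b where "b = c n"
    have cl: "P \<in> carrier R" "Q \<in> carrier R" "u \<in> carrier R" "v \<in> carrier R" "b \<in> carrier R"
      using assms by (auto simp: P_def Q_def u_def v_def b_def)
    have "P \<oplus> b \<otimes> u \<ominus> (Q \<oplus> b \<otimes> v) = (P \<ominus> Q) \<oplus> b \<otimes> (u \<ominus> v)"
      using cl by algebra
    moreover have "P \<ominus> Q \<in> I" using Suc by (simp add: P_def Q_def)
    moreover have "u \<ominus> v \<in> I" using ideal_pow_cong assms by (simp add: u_def v_def)
    ultimately show ?case
      using cl by (simp add: P_def Q_def u_def v_def b_def I_l_closed a_closed)
  qed
qed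

end

section \<open>Ramified discrete valuation rings modulo the square of the uniformizer\<close>

context ramified_dvr
begin

abbreviation I\<^sub>1 where "I\<^sub>1 \<equiv> PIdl \<pi>"
abbreviation I\<^sub>2 where "I\<^sub>2 \<equiv> PIdl (\<pi> \<otimes> \<pi>)"

sublocale I\<^sub>1: maximalideal I\<^sub>1 V
  by (rule maximalideal_uniformizer)

sublocale I\<^sub>1: primeideal I\<^sub>1 V
  by (rule maximalideal_prime[OF maximalideal_uniformizer])

sublocale I\<^sub>2: ideal I\<^sub>2 V
  by (rule cgenideal_ideal) (simp add: uniformizer_closed)

lemma I\<^sub>2_subset: "I\<^sub>2 \<subseteq> I\<^sub>1"
  unfolding cgenideal_def using uniformizer_closed by (auto simp: m_assoc[symmetric])

text \<open>A zero uniformizer would make the zero ideal maximal and \<open>V\<close> a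
  field.\<close>

lemma uniformizer_nonzero: "\<pi> \<noteq> \<zero>"
proof
  assume "\<pi> = \<zero>"
  then have "maximalideal {\<zero>} V"
    using maximalideal_uniformizer by (simp add: cgenideal_eq_genideal genideal_zero)
  then show False using zeromaximalideal_eq_field not_field by blast
qed

lemma mem_I\<^sub>1: "x \<in> I\<^sub>1 \<longleftrightarrow> (\<exists>w\<in>carrier V. x = \<pi> \<otimes> w)"
  unfolding cgenideal_def using uniformizer_closed by (auto simp: m_comm)

text \<open>The form with one visible factor \<open>\<pi>\<close> allows this factor to be
  cancelled, as in the next lemma.\<close>

lemma mem_I\<^sub>2: "x \<in> I\<^sub>2 \<longleftrightarrow> (\<exists>w\<in>I\<^sub>1. x = \<pi> \<otimes> w)"
proof -
  have "x \<in> I\<^sub>2 \<longleftrightarrow> (\<exists>w\<in>carrier V. x = \<pi> \<otimes> (\<pi> \<otimes> w))"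
    unfolding cgenideal_def using uniformizer_closed by (auto simp: m_ac)
  then show ?thesis unfolding Bex_def mem_I\<^sub>1 by blast
qed

lemma uniformizer_mult_mem_I\<^sub>2:
  assumes "w \<in> carrier V" "\<pi> \<otimes> w \<in> I\<^sub>2"
  shows "w \<in> I\<^sub>1"
proof -
  obtain w' where w': "w' \<in> I\<^sub>1" "\<pi> \<otimes> w = \<pi> \<otimes> w'" using assms(2) unfolding mem_I\<^sub>2 by blast
  then have "w' \<in> carrier V" using I\<^sub>1.a_subset by blast
  then have "w = w'"
    using m_lcancel[OF uniformizer_nonzero uniformizer_closed assms(1)] w'(2) by blast
  then show ?thesis using w'(1) by simp
qed

text \<open>The characteristic is encoded as the additive order of one, and a multiple of one
  vanishes in the residue ring exactly when this order divides the multiplier.\<close>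

lemma residue_char_eq_0_iff: "[k] \<cdot> \<one> \<in> I\<^sub>1 \<longleftrightarrow> p dvd k"
proof -
  have zero: "\<zero>\<^bsub>V Quot I\<^sub>1\<^esub> = I\<^sub>1" by (simp add: FactRing_def)
  interpret Q: ring "V Quot I\<^sub>1" by (rule I\<^sub>1.quotient_is_ring)
  interpret h: ring_hom_ring V "V Quot I\<^sub>1" "(+>) I\<^sub>1" by (rule I\<^sub>1.rcos_ring_hom_ring)
  have h: "I\<^sub>1 +> [k] \<cdot> \<one> = [k] \<cdot>\<^bsub>V Quot I\<^sub>1\<^esub> \<one>\<^bsub>V Quot I\<^sub>1\<^esub>"
    by (induction k) (auto simp: h.hom_zero)
  have "[k] \<cdot> \<one> \<in> I\<^sub>1 \<longleftrightarrow> I\<^sub>1 +> [k] \<cdot> \<one> = I\<^sub>1"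
    using I\<^sub>1.rcos_const_imp_mem[of "[k] \<cdot> \<one>"] I\<^sub>1.a_rcos_const[of "[k] \<cdot> \<one>"] by blast
  also have "\<dots> \<longleftrightarrow> [k] \<cdot>\<^bsub>V Quot I\<^sub>1\<^esub> \<one>\<^bsub>V Quot I\<^sub>1\<^esub> = \<zero>\<^bsub>V Quot I\<^sub>1\<^esub>"
    unfolding h zero ..
  also have "\<dots> \<longleftrightarrow> group.ord (add_monoid (V Quot I\<^sub>1)) \<one>\<^bsub>V Quot I\<^sub>1\<^esub> dvd k"
    using group.pow_eq_id[OF Q.add.is_group, of "\<one>\<^bsub>V Quot I\<^sub>1\<^esub>" k] by (simp add: add_pow_def)
  finally show ?thesis using ring_char_residue_field by (simp add: ring_char_def)
qed

text \<open>Primality of the ideal \<open>I\<^sub>1\<close> carries over to the number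
  \<open>p\<close> through \<open>residue_char_eq_0_iff\<close>.\<close>

lemma prime_residue_char: "prime p"
proof -
  have "\<not> p dvd 1" using residue_char_eq_0_iff[of 1] I\<^sub>1.one_imp_carrier I\<^sub>1.I_notcarr by auto
  moreover have "p dvd a \<or> p dvd b" if "p dvd a * b" for a b
  proof -
    have "[(a * b)] \<cdot> \<one> = [a] \<cdot> \<one> \<otimes> [b] \<cdot> \<one>"
      by (simp add: add_pow_ldistr add.nat_pow_pow mult.commute)
    moreover have "[(a * b)] \<cdot> \<one> \<in> I\<^sub>1" using that residue_char_eq_0_iff by blast
    moreover have "[a] \<cdot> \<one> \<in> carrier V" "[b] \<cdot> \<one> \<in> carrier V" by simp_all
    ultimately show ?thesis
      using I\<^sub>1.I_prime residue_char_eq_0_iff by metis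
  qed
  ultimately have "prime_elem p"
    using residue_char_pos unfolding prime_elem_def by blast
  then show ?thesis by simp
qed

lemma mult_mem_I\<^sub>2:
  assumes "x \<in> I\<^sub>1" "y \<in> I\<^sub>1"
  shows "x \<otimes> y \<in> I\<^sub>2"
proof -
  obtain v where v: "v \<in> carrier V" "x = \<pi> \<otimes> v" using assms(1) unfolding mem_I\<^sub>1 by blast
  have "x \<otimes> y = \<pi> \<otimes> (v \<otimes> y)"
    using v assms(2) I\<^sub>1.a_subset uniformizer_closed by (simp add: m_assoc subset_iff)
  then show ?thesis using I\<^sub>1.I_l_closed[OF assms(2) v(1)] unfolding mem_I\<^sub>2 by blast
qed

text \<open>Ramification is stated with the ideal product; its elements are sums of products of two
  elements of \<open>I\<^sub>1\<close>, and each such product is a multiple of the square of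
  \<open>\<pi>\<close>.\<close>

lemma residue_char_mem_I\<^sub>2: "[p] \<cdot> \<one> \<in> I\<^sub>2"
proof -
  have "x \<in> I\<^sub>2" if "x \<in> ideal_prod V I\<^sub>1 I\<^sub>1" for x
    using that by (induction rule: ideal_prod.induct) (auto intro: mult_mem_I\<^sub>2 I\<^sub>2.a_closed)
  then show ?thesis using ramified by blast
qed

lemma residue_char_ge_2: "p \<ge> 2"
  by (rule prime_ge_2_nat[OF prime_residue_char])

text \<open>Since \<open>p \<ge> 2\<close>, the power contains the factor
  \<open>v \<otimes> v\<close>.\<close>

lemma pow_residue_char_mem_I\<^sub>2:
  assumes "v \<in> I\<^sub>1"
  shows "v [^] p \<in> I\<^sub>2"
proof -
  obtain q where q: "p = Suc (Suc q)"
    using residue_char_ge_2 by (metis add_2_eq_Suc le_Suc_ex)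
  have v: "v \<in> carrier V" using assms I\<^sub>1.a_subset by auto
  then have "v [^] p = v [^] q \<otimes> (v \<otimes> v)" by (simp add: q m_assoc)
  then show ?thesis using v mult_mem_I\<^sub>2[OF assms assms] by (simp add: I\<^sub>2.I_l_closed)
qed

lemma pow_mem_I\<^sub>1_imp: "v \<in> carrier V \<Longrightarrow> v [^] (n::nat) \<in> I\<^sub>1 \<Longrightarrow> v \<in> I\<^sub>1"
proof (induction n)
  case 0
  then show ?case using I\<^sub>1.one_imp_carrier I\<^sub>1.I_notcarr by auto
next
  case (Suc n)
  then show ?case using I\<^sub>1.I_prime[of "v [^] n" v] by auto
qed

text \<open>Maximality of \<open>I\<^sub>1\<close> gives
  \<open>\<one> = s \<oplus> t \<otimes> v\<close> with \<open>s\<close> in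
  \<open>I\<^sub>1\<close>. Multiplying the inverse \<open>t\<close> modulo \<open>I\<^sub>1\<close>
  by \<open>\<one> \<oplus> s\<close> improves the error from \<open>s\<close> to its square, which
  lies in \<open>I\<^sub>2\<close>.\<close>

lemma inverse_mod_I\<^sub>2:
  assumes v: "v \<in> carrier V" "v \<notin> I\<^sub>1"
  shows "\<exists>u\<in>carrier V. u \<otimes> v \<ominus> \<one> \<in> I\<^sub>2"
proof -
  interpret P: ideal "PIdl v" V using v by (rule_tac cgenideal_ideal)
  let ?J = "set_add V I\<^sub>1 (PIdl v)"
  have J: "ideal ?J V" by (rule add_ideals) (rule I\<^sub>1.is_ideal, rule P.is_ideal)
  have "x \<oplus> \<zero> \<in> ?J" if "x \<in> I\<^sub>1" for x
    using that P.zero_closed unfolding set_add_def' by blast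
  then have "I\<^sub>1 \<subseteq> ?J" using I\<^sub>1.a_subset by (metis r_zero subset_iff)
  moreover have "\<zero> \<oplus> v \<in> ?J"
    using cgenideal_self[OF v(1)] I\<^sub>1.zero_closed unfolding set_add_def' by blast
  then have "v \<in> ?J" using v by simp
  ultimately have "?J = carrier V"
    using v I\<^sub>1.I_maximal[OF J] additive_subgroup.a_subset[OF ideal.axioms(1)[OF J]] by blast
  then obtain s t where st: "s \<in> I\<^sub>1" "t \<in> carrier V" "\<one> = s \<oplus> t \<otimes> v"
    unfolding set_add_def' cgenideal_def using one_closed by blast
  have s: "s \<in> carrier V" using st I\<^sub>1.a_subset by auto
  have "t \<otimes> v = \<one> \<ominus> s" 
  proof -
    have "x = s \<oplus> x \<ominus> s" if "x \<in> carrier V" for x using s that by algebra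
    then show ?thesis using st v by simp
  qed
  then have "((\<one> \<oplus> s) \<otimes> t) \<otimes> v \<ominus> \<one> = (\<one> \<oplus> s) \<otimes> (\<one> \<ominus> s) \<ominus> \<one>"
    using st(2) s v by (simp add: m_assoc)
  also have "\<dots> = \<ominus> (s \<otimes> s)" using s by algebra
  finally have "((\<one> \<oplus> s) \<otimes> t) \<otimes> v \<ominus> \<one> \<in> I\<^sub>2"
    using mult_mem_I\<^sub>2 st by (simp add: I\<^sub>2.a_inv_closed)
  then show ?thesis using s st by blast
qed

end

section \<open>Coefficient rings\<close>

context ramified_dvr
begin

text \<open>The last condition says that the quotient of \<open>B\<close> by
  \<open>I\<^sub>2\<close> embeds in the residue field. Containing all \<open>p\<close>-th powers
  makes this quotient a field, as \<open>coeff_subring_inverse\<close> shows.\<close>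

definition coeff_subring where
  "coeff_subring B \<longleftrightarrow> subring B V \<and> I\<^sub>2 \<subseteq> B \<and> (\<forall>v\<in>carrier V. v [^] p \<in> B) \<and> B \<inter> I\<^sub>1 \<subseteq> I\<^sub>2"

text \<open>Modulo \<open>I\<^sub>2\<close> the \<open>p\<close>-th power map is additive because
  ramification puts \<open>p\<close> in \<open>I\<^sub>2\<close>, so its image is a subring. If
  \<open>v [^] p\<close> lies in \<open>I\<^sub>1\<close> then so does \<open>v\<close>, and the
  power already lies in \<open>I\<^sub>2\<close>.\<close>

lemma ex_coeff_subring: "\<exists>B. coeff_subring B"
proof -
  define B where "B = {v [^] p \<oplus> z |v z. v \<in> carrier V \<and> z \<in> I\<^sub>2}"
  have BI: "v [^] p \<oplus> z \<in> B" if "v \<in> carrier V" "z \<in> I\<^sub>2" for v z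
    using that unfolding B_def by blast
  have BE: "\<exists>v\<in>carrier V. \<exists>z\<in>I\<^sub>2. x = v [^] p \<oplus> z" if "x \<in> B" for x
    using that unfolding B_def by blast
  have I\<^sub>2c: "z \<in> carrier V" if "z \<in> I\<^sub>2" for z using that I\<^sub>2.a_subset by auto
  have pow: "v [^] p \<in> B" if "v \<in> carrier V" for v
    using BI[OF that I\<^sub>2.zero_closed] that by simp
  have mult: "x \<otimes> y \<in> B" if xy: "x \<in> B" "y \<in> B" for x y
  proof -
    obtain v z w z' where x: "v \<in> carrier V" "z \<in> I\<^sub>2" "x = v [^] p \<oplus> z"
      and y: "w \<in> carrier V" "z' \<in> I\<^sub>2" "y = w [^] p \<oplus> z'"
      using BE[OF xy(1)] BE[OF xy(2)] by blast
    have "x \<otimes> y = (v \<otimes> w) [^] p \<oplus> (v [^] p \<otimes> z' \<oplus> z \<otimes> (w [^] p \<oplus> z'))"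
      using x y I\<^sub>2c by (simp add: nat_pow_distrib l_distr r_distr a_ac)
    moreover have "v [^] p \<otimes> z' \<in> I\<^sub>2" using x y by (simp add: I\<^sub>2.I_l_closed)
    moreover have "z \<otimes> (w [^] p \<oplus> z') \<in> I\<^sub>2" using x y I\<^sub>2c by (simp add: I\<^sub>2.I_r_closed)
    ultimately show ?thesis using x y by (auto intro!: BI I\<^sub>2.a_closed)
  qed
  have add: "x \<oplus> y \<in> B" if xy: "x \<in> B" "y \<in> B" for x y
  proof -
    obtain v z w z' where x: "v \<in> carrier V" "z \<in> I\<^sub>2" "x = v [^] p \<oplus> z"
      and y: "w \<in> carrier V" "z' \<in> I\<^sub>2" "y = w [^] p \<oplus> z'"
      using BE[OF xy(1)] BE[OF xy(2)] by blast
    obtain t where t: "t \<in> I\<^sub>2" "(v \<oplus> w) [^] p = v [^] p \<oplus> w [^] p \<oplus> t"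
      using freshmans_dream[OF I\<^sub>2.is_ideal prime_residue_char residue_char_mem_I\<^sub>2] x y by blast
    have cl: "v [^] p \<in> carrier V" "w [^] p \<in> carrier V" "z \<in> carrier V" "z' \<in> carrier V"
      "t \<in> carrier V" using x y t I\<^sub>2c by auto
    \<comment> \<open>The error \<open>t\<close> of the freshman's dream is absorbed into the
      component in \<open>I\<^sub>2\<close>.\<close>
    have "x \<oplus> y = (v \<oplus> w) [^] p \<oplus> (z \<oplus> z' \<ominus> t)"
      unfolding x(3) y(3) t(2) using cl by algebra
    moreover have "z \<oplus> z' \<ominus> t \<in> I\<^sub>2" using x y t by (simp add: I\<^sub>2.a_closed I\<^sub>2.mem_minus)
    ultimately show ?thesis using BI[of "v \<oplus> w" "z \<oplus> z' \<ominus> t"] x(1) y(1) by simp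
  qed
  \<comment> \<open>To avoid a distinction on the parity of \<open>p\<close>, the freshman's dream
    is applied to one plus minus one, whose \<open>p\<close>-th power is zero.\<close>
  have "\<ominus> \<one> \<in> B"
  proof -
    obtain t where t: "t \<in> I\<^sub>2" "(\<one> \<oplus> \<ominus> \<one>) [^] p = \<one> [^] p \<oplus> (\<ominus> \<one>) [^] p \<oplus> t"
      using freshmans_dream[OF I\<^sub>2.is_ideal prime_residue_char residue_char_mem_I\<^sub>2, of \<one> "\<ominus> \<one>"]
      by auto
    have cl: "(\<ominus> \<one>) [^] p \<in> carrier V" "t \<in> carrier V" using t I\<^sub>2c by auto
    have "\<zero> = \<one> \<oplus> (\<ominus> \<one>) [^] p \<oplus> t"
      using t(2) residue_char_pos by (simp add: r_neg nat_pow_zero)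
    then have "\<ominus> \<one> \<oplus> \<zero> = \<ominus> \<one> \<oplus> (\<one> \<oplus> (\<ominus> \<one>) [^] p \<oplus> t)" by simp
    also have "\<dots> = (\<ominus> \<one>) [^] p \<oplus> t" using cl by algebra
    finally show ?thesis using BI[of "\<ominus> \<one>" t] t by simp
  qed
  have sub: "B \<subseteq> carrier V" unfolding B_def using I\<^sub>2c by auto
  have "subring B V"
  proof (rule subringI[OF sub])
    show "\<one> \<in> B" using pow[of \<one>] by simp
    show "\<ominus> x \<in> B" if "x \<in> B" for x
      using mult[OF \<open>\<ominus> \<one> \<in> B\<close> that] sub that by (auto simp: l_minus)
  qed (use mult add in auto)
  moreover have "I\<^sub>2 \<subseteq> B"
  proof
    fix z assume "z \<in> I\<^sub>2"
    then show "z \<in> B" using BI[of \<zero> z] I\<^sub>2c residue_char_pos by (simp add: nat_pow_zero)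
  qed
  moreover have "x \<in> I\<^sub>2" if "x \<in> B" "x \<in> I\<^sub>1" for x
  proof -
    obtain v z where x: "v \<in> carrier V" "z \<in> I\<^sub>2" "x = v [^] p \<oplus> z"
      using BE[OF \<open>x \<in> B\<close>] by blast
    then have "v [^] p = x \<ominus> z" using I\<^sub>2c[of z] nat_pow_closed[of v p] by algebra
    moreover have "x \<ominus> z \<in> I\<^sub>1" using I\<^sub>1.mem_minus[OF that(2)] x(2) I\<^sub>2_subset by blast
    ultimately have "v [^] p \<in> I\<^sub>1" by metis
    then have "v \<in> I\<^sub>1" using pow_mem_I\<^sub>1_imp x by blast
    then show ?thesis using x pow_residue_char_mem_I\<^sub>2 I\<^sub>2.a_closed by blast
  qed
  ultimately have "coeff_subring B" unfolding coeff_subring_def using pow by blast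
  then show ?thesis ..
qed

text \<open>Zorn's lemma: the defining conditions pass to the union of a nonempty chain, since any
  two elements of the union lie in a common member.\<close>

lemma ex_maximal_coeff_subring:
  "\<exists>B. coeff_subring B \<and> (\<forall>B'. coeff_subring B' \<longrightarrow> B \<subseteq> B' \<longrightarrow> B' = B)"
proof -
  have "\<exists>M\<in>Collect coeff_subring. \<forall>N\<in>Collect coeff_subring. M \<subseteq> N \<longrightarrow> N = M"
  proof (rule subset_Zorn_nonempty)
    show "Collect coeff_subring \<noteq> {}" using ex_coeff_subring by blast
    fix C assume C: "C \<noteq> {}" "subset.chain (Collect coeff_subring) C"
    then have B: "coeff_subring B" if "B \<in> C" for B using that by (auto simp: subset_chain_def)
    then have sub: "subring B V" if "B \<in> C" for B using that by (simp add: coeff_subring_def)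
    obtain B\<^sub>0 where B\<^sub>0: "B\<^sub>0 \<in> C" using C by blast
    have two: "\<exists>B\<in>C. x \<in> B \<and> y \<in> B" if "x \<in> \<Union>C" "y \<in> \<Union>C" for x y
      using that C(2) unfolding subset_chain_def by blast
    have "subring (\<Union>C) V"
    proof (rule subringI)
      show "\<Union>C \<subseteq> carrier V" using subringE(1)[OF sub] by blast
      show "\<one> \<in> \<Union>C" using subringE(3)[OF sub[OF B\<^sub>0]] B\<^sub>0 by blast
      fix x y assume xy: "x \<in> \<Union>C" "y \<in> \<Union>C"
      obtain B where "B \<in> C" "x \<in> B" "y \<in> B" using two[OF xy] by blast
      then show "\<ominus> x \<in> \<Union>C" "x \<otimes> y \<in> \<Union>C" "x \<oplus> y \<in> \<Union>C"
        using subringE(5-7)[OF sub] by blast+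
    qed
    moreover have "I\<^sub>2 \<subseteq> \<Union>C" "\<forall>v\<in>carrier V. v [^] p \<in> \<Union>C"
      using B[OF B\<^sub>0] B\<^sub>0 unfolding coeff_subring_def by blast+
    moreover have "\<Union>C \<inter> I\<^sub>1 \<subseteq> I\<^sub>2" using B unfolding coeff_subring_def by blast
    ultimately show "\<Union>C \<in> Collect coeff_subring" by (simp add: coeff_subring_def)
  qed
  then show ?thesis by auto
qed

section \<open>Extending a candidate to meet a given residue class\<close>

context
  fixes B
  assumes B: "coeff_subring B"
begin

lemma coeff_subring_subring: "subring B V"
  and coeff_subring_I\<^sub>2: "I\<^sub>2 \<subseteq> B"
  and coeff_subring_pow: "v \<in> carrier V \<Longrightarrow> v [^] p \<in> B"
  and coeff_subring_Int: "b \<in> B \<Longrightarrow> b \<in> I\<^sub>1 \<Longrightarrow> b \<in> I\<^sub>2"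
  using B by (auto simp: coeff_subring_def)

lemmas coeff_subring_carrier = subringE(1)[OF coeff_subring_subring, THEN subsetD]

text \<open>If \<open>u\<close> inverts \<open>b\<close> modulo \<open>I\<^sub>2\<close> in
  \<open>V\<close>, then so does the product of \<open>u [^] p\<close> with the power of
  \<open>b\<close> of exponent \<open>p - 1\<close>, and both of these factors lie in
  \<open>B\<close>.\<close>

lemma coeff_subring_inverse:
  assumes "b \<in> B" "b \<notin> I\<^sub>1"
  shows "\<exists>u\<in>B. u \<otimes> b \<ominus> \<one> \<in> I\<^sub>2"
proof -
  have b: "b \<in> carrier V" using assms coeff_subring_carrier by auto
  obtain u where u: "u \<in> carrier V" "u \<otimes> b \<ominus> \<one> \<in> I\<^sub>2"
    using inverse_mod_I\<^sub>2[OF b assms(2)] by blast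
  obtain q where q: "p = Suc q" using residue_char_pos gr0_implies_Suc by blast
  have bq: "b [^] n \<in> B" for n :: nat
    by (induction n) (use assms subringE(3,6)[OF coeff_subring_subring] in auto)
  have "u [^] p \<otimes> b [^] q \<otimes> b = (u \<otimes> b) [^] p"
    using u b by (simp add: q nat_pow_distrib m_ac)
  moreover have "(u \<otimes> b) [^] p \<ominus> \<one> [^] p \<in> I\<^sub>2"
    using ideal_pow_cong[OF I\<^sub>2.is_ideal u(2)] u b by simp
  ultimately show ?thesis
    using coeff_subring_pow[OF u(1)] bq subringE(6)[OF coeff_subring_subring] by (metis nat_pow_one)
qed

text \<open>The summand \<open>y\<close> collects the terms of exponent below \<open>d\<close>. The
  least such \<open>d\<close> is the degree of the residue class of \<open>a\<close> over the image
  of \<open>B\<close> in the residue field.\<close>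

definition monic_relation_degree where
  "monic_relation_degree a d \<longleftrightarrow> (\<exists>y\<in>pspan B d a. y \<oplus> a [^] (d::nat) \<in> I\<^sub>1)"

text \<open>The relation depends only on the residue class, so minimality of the degree survives the
  replacement of \<open>a\<close> by a congruent element.\<close>

lemma monic_relation_degree_cong:
  assumes "monic_relation_degree a d" "a' \<ominus> a \<in> I\<^sub>1" "a \<in> carrier V" "a' \<in> carrier V"
  shows "monic_relation_degree a' d"
proof -
  obtain c where c: "range c \<subseteq> B" "peval c d a \<oplus> a [^] d \<in> I\<^sub>1"
    using assms(1) unfolding monic_relation_degree_def pspan_def by blast
  have cc: "range c \<subseteq> carrier V" using c coeff_subring_carrier by auto
  define P where "P = peval c d a"
  define P' where "P' = peval c d a'"
  define e where "e = a [^] d"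
  define e' where "e' = a' [^] d"
  have cl: "P \<in> carrier V" "P' \<in> carrier V" "e \<in> carrier V" "e' \<in> carrier V"
    using assms cc by (auto simp: P_def P'_def e_def e'_def)
  have "P' \<ominus> P \<in> I\<^sub>1"
    using ideal_peval_cong[OF I\<^sub>1.is_ideal assms(2) _ _ cc] assms by (simp add: P_def P'_def)
  moreover have "e' \<ominus> e \<in> I\<^sub>1"
    using ideal_pow_cong[OF I\<^sub>1.is_ideal assms(2)] assms by (simp add: e_def e'_def)
  moreover have "P \<oplus> e \<in> I\<^sub>1" using c by (simp add: P_def e_def)
  moreover have "P' \<oplus> e' = (P' \<ominus> P) \<oplus> ((e' \<ominus> e) \<oplus> (P \<oplus> e))" using cl by algebra
  ultimately have "P' \<oplus> e' \<in> I\<^sub>1" by (simp add: I\<^sub>1.a_closed)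
  then show ?thesis using c(1) unfolding monic_relation_degree_def pspan_def P'_def e'_def by blast
qed

text \<open>Linear independence of the powers of \<open>a\<close> below \<open>d\<close>, modulo
  \<open>I\<^sub>1\<close>. A top coefficient outside \<open>I\<^sub>1\<close> could be inverted
  within \<open>B\<close>, turning the combination into a monic relation of degree below
  \<open>d\<close>; otherwise its term is dropped and the shorter combination is treated by
  induction.\<close>

lemma peval_mem_I\<^sub>1_imp:
  assumes "\<And>e. e < d \<Longrightarrow> \<not> monic_relation_degree a e" "a \<in> carrier V" "range c \<subseteq> B" "n \<le> d"
    "peval c n a \<in> I\<^sub>1" "i < n"
  shows "c i \<in> I\<^sub>1"
  using assms(4-6)
proof (induction n)
  case (Suc n)
  have cn: "c n \<in> B" and cc: "range c \<subseteq> carrier V" using assms(3) coeff_subring_carrier by auto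
  then have cnc: "c n \<in> carrier V" by auto
  have P: "peval c n a \<in> carrier V" using cc assms(2) by blast
  have top: "c n \<in> I\<^sub>1"
  proof (rule ccontr)
    assume "c n \<notin> I\<^sub>1"
    then obtain u where u: "u \<in> B" "u \<otimes> c n \<ominus> \<one> \<in> I\<^sub>2"
      using coeff_subring_inverse cn by blast
    have uc: "u \<in> carrier V" using u coeff_subring_carrier by auto
    have "u \<otimes> (peval c n a \<oplus> c n \<otimes> a [^] n) \<in> I\<^sub>1"
      using Suc.prems uc by (simp add: I\<^sub>1.I_l_closed)
    moreover have "(u \<otimes> c n \<ominus> \<one>) \<otimes> a [^] n \<in> I\<^sub>1"
      using u(2) I\<^sub>2_subset assms(2) by (auto intro!: I\<^sub>1.I_r_closed)
    moreover have "u \<otimes> P \<oplus> A = u \<otimes> (P \<oplus> C \<otimes> A) \<ominus> (u \<otimes> C \<ominus> \<one>) \<otimes> A"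
      if "P \<in> carrier V" "A \<in> carrier V" "C \<in> carrier V" for P A C
    proof -
      have "u \<otimes> P \<oplus> E \<otimes> A = u \<otimes> (P \<oplus> C \<otimes> A) \<ominus> (u \<otimes> C \<ominus> E) \<otimes> A"
        if "E \<in> carrier V" for E
        using that \<open>P \<in> carrier V\<close> \<open>A \<in> carrier V\<close> \<open>C \<in> carrier V\<close> uc by algebra
      from this[of \<one>] show ?thesis using that by simp
    qed
    ultimately have "u \<otimes> peval c n a \<oplus> a [^] n \<in> I\<^sub>1"
      using P cnc assms(2) I\<^sub>1.mem_minus nat_pow_closed by metis
    moreover have "u \<otimes> peval c n a \<in> pspan B n a"
      using pspan_smult[OF coeff_subring_subring assms(2) u(1)] assms(3) unfolding pspan_def by blast
    ultimately have "monic_relation_degree a n" unfolding monic_relation_degree_def by blast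
    then show False using assms(1) Suc.prems by simp
  qed
  show ?case
  proof (cases "i = n")
    case False
    have "peval c n a = peval c (Suc n) a \<ominus> c n \<otimes> a [^] n"
      using P cnc assms(2) by (simp add: minus_eq a_assoc r_neg)
    then have "peval c n a \<in> I\<^sub>1"
      using Suc.prems top assms(2) by (simp add: I\<^sub>1.mem_minus I\<^sub>1.I_r_closed del: peval.simps)
    then show ?thesis using Suc False by simp
  qed (use top in simp)
qed simp

text \<open>An element of the span lying in \<open>I\<^sub>1\<close> has all its coefficients in
  \<open>I\<^sub>1\<close> by linear independence. As members of \<open>B\<close> these lie in
  \<open>I\<^sub>2\<close>, and so does the element.\<close>

lemma coeff_subring_pspan:
  assumes "\<And>e. e < d \<Longrightarrow> \<not> monic_relation_degree a e" "a \<in> carrier V" "d > 0" "a [^] d \<in> pspan B d a"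
  shows "coeff_subring (pspan B d a)"
proof -
  have const: "B \<subseteq> pspan B d a" using pspan_const[OF coeff_subring_subring assms(2,3)] by blast
  have "x \<in> I\<^sub>2" if x: "x \<in> pspan B d a" "x \<in> I\<^sub>1" for x
  proof -
    obtain c where c: "range c \<subseteq> B" "x = peval c d a" using x unfolding pspan_def by blast
    have "c i \<in> I\<^sub>2" if "i < d" for i
      using peval_mem_I\<^sub>1_imp[OF assms(1,2) c(1) order_refl _ that] \<open>x \<in> I\<^sub>1\<close> c
        coeff_subring_Int[of "c i"] by auto
    then show ?thesis using c assms(2) by (auto intro: I\<^sub>2.peval_mem)
  qed
  then show ?thesis
    using const subring_pspan[OF coeff_subring_subring assms(2-4)] coeff_subring_I\<^sub>2 coeff_subring_pow
    unfolding coeff_subring_def by blast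
qed

text \<open>If \<open>d < p\<close>, the derivative of a monic relation of minimal degree \<open>d\<close> has degree
  \<open>d - 1\<close>, so it is a unit at \<open>a\<close> and Newton's method lifts the root modulo \<open>I\<^sub>2\<close>.\<close>

lemma newton_step:
  assumes min: "\<And>e. e < d \<Longrightarrow> \<not> monic_relation_degree a e" and a: "a \<in> carrier V" and "monic_relation_degree a d"
    and d: "d > 0" "d < p"
  shows "\<exists>a'\<in>carrier V. a' \<ominus> a \<in> I\<^sub>1 \<and> a' [^] d \<in> pspan B d a'"
proof -
  obtain c where c: "range c \<subseteq> B" "peval c d a \<oplus> a [^] d \<in> I\<^sub>1"
    using assms(3) unfolding monic_relation_degree_def pspan_def by blast
  \<comment> \<open>\<open>f\<close> lists the coefficients of the whole monic relation, including
    the leading one at index \<open>d\<close>; \<open>g\<close> lists those of its formal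
    derivative.\<close>
  define f where "f i = (if i = d then \<one> else c i)" for i
  define g where "g i = [Suc i] \<cdot> f (Suc i)" for i
  have f: "range f \<subseteq> B" using c subringE(3)[OF coeff_subring_subring] by (auto simp: f_def)
  have Bpow: "[k] \<cdot> b \<in> B" if "b \<in> B" for k :: nat and b
    by (induction k) (use that subringE(2,7)[OF coeff_subring_subring] in auto)
  have g: "range g \<subseteq> B" using f Bpow unfolding g_def by blast
  have fc: "range f \<subseteq> carrier V" and gc: "range g \<subseteq> carrier V" using f g coeff_subring_carrier by auto
  have f_eval: "peval f (Suc d) x = peval c d x \<oplus> x [^] d" if "x \<in> carrier V" for x
  proof -
    have "n \<le> d \<Longrightarrow> peval f n x = peval c n x" for n by (induction n) (auto simp: f_def)
    then show ?thesis using that by (simp add: f_def)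
  qed
  define G where "G = peval g d a"
  have Gc: "G \<in> carrier V" using gc a by (auto simp: G_def)
  \<comment> \<open>The leading coefficient of the derivative is \<open>d\<close>, which is nonzero
    in the residue field because \<open>0 < d < p\<close>. Linear independence then keeps the value
    \<open>G\<close> of the derivative out of \<open>I\<^sub>1\<close>.\<close>
  have "g (d - 1) = [d] \<cdot> \<one>" using d by (simp add: g_def f_def del: add.nat_pow_Suc)
  then have "g (d - 1) \<notin> I\<^sub>1" using residue_char_eq_0_iff[of d] d nat_dvd_not_less by simp
  then have "G \<notin> I\<^sub>1"
    using peval_mem_I\<^sub>1_imp[OF min a g, where n = d and d = d and i = "d - 1"] d by (auto simp: G_def)
  then obtain u where u: "u \<in> carrier V" "u \<otimes> G \<ominus> \<one> \<in> I\<^sub>2" using inverse_mod_I\<^sub>2 Gc by blast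
  obtain s where s: "s \<in> carrier V" "peval f (Suc d) a = \<pi> \<otimes> s"
    using c(2) f_eval[OF a] unfolding mem_I\<^sub>1 by auto
  \<comment> \<open>The Newton correction, minus the value divided by the derivative: the value at
    \<open>a\<close> is \<open>\<pi> \<otimes> s\<close>, and \<open>u\<close> inverts
    \<open>G\<close> modulo \<open>I\<^sub>2\<close>.\<close>
  define w where "w = \<pi> \<otimes> (\<ominus> (s \<otimes> u))"
  note pc = uniformizer_closed
  have w: "w \<in> carrier V" "w \<in> I\<^sub>1"
    using s u pc unfolding w_def mem_I\<^sub>1 by auto
  obtain z where z: "z \<in> carrier V"
    "peval f (Suc d) (a \<oplus> w) = peval f (Suc d) a \<oplus> w \<otimes> G \<oplus> w \<otimes> w \<otimes> z"
    using peval_taylor[OF fc a w(1), of d] unfolding G_def g_def[abs_def] by blast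
  have "\<pi> \<otimes> s \<oplus> w \<otimes> G \<oplus> w \<otimes> w \<otimes> z = w \<otimes> w \<otimes> z \<ominus> \<pi> \<otimes> s \<otimes> (u \<otimes> G \<ominus> \<one>)"
    unfolding w_def using pc s(1) u(1) Gc z(1) by algebra
  moreover have "w \<otimes> w \<otimes> z \<in> I\<^sub>2" "\<pi> \<otimes> s \<otimes> (u \<otimes> G \<ominus> \<one>) \<in> I\<^sub>2"
    using mult_mem_I\<^sub>2[OF w(2) w(2)] z(1) u(2) pc s(1)
    by (auto intro: I\<^sub>2.I_r_closed I\<^sub>2.I_l_closed)
  ultimately have root: "peval f (Suc d) (a \<oplus> w) \<in> I\<^sub>2"
    using z(2) s(2) I\<^sub>2.mem_minus by simp
  define a' where "a' = a \<oplus> w"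
  have a': "a' \<in> carrier V" using a w by (simp add: a'_def)
  define P where "P = peval c d a'"
  define R where "R = peval f (Suc d) a'"
  have P: "P \<in> pspan B d a'" using c unfolding P_def pspan_def by blast
  then have Pc: "P \<in> carrier V" using pspan_subset[OF coeff_subring_subring a'] by blast
  \<comment> \<open>The value at the new point lies in \<open>I\<^sub>2\<close> and hence in
    \<open>B\<close>, so it counts as a constant; the relation can then be solved for
    \<open>a' [^] d\<close>.\<close>
  have R: "R \<in> pspan B d a'"
    using root pspan_const[OF coeff_subring_subring a' d(1)] coeff_subring_I\<^sub>2 by (auto simp: R_def a'_def)
  then have Rc: "R \<in> carrier V" using pspan_subset[OF coeff_subring_subring a'] by blast
  have "R = P \<oplus> a' [^] d" using f_eval[OF a'] by (simp add: R_def P_def)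
  moreover have "e = P \<oplus> e \<oplus> \<ominus> P" if "e \<in> carrier V" for e using Pc that by algebra
  ultimately have "a' [^] d = R \<oplus> \<ominus> P" using a' by simp
  then have "a' [^] d \<in> pspan B d a'"
    using pspan_add[OF coeff_subring_subring a' R pspan_minus[OF coeff_subring_subring a' P]] by simp
  moreover have "a' \<ominus> a = w" using a w unfolding a'_def by algebra
  ultimately show ?thesis using a' w by metis
qed

text \<open>Applied to a maximal \<open>B\<close>, this yields an element of \<open>B\<close> itself
  in the residue class of \<open>a\<close>.\<close>

lemma coeff_subring_extend:
  assumes a: "a \<in> carrier V"
  shows "\<exists>B' a'. coeff_subring B' \<and> B \<subseteq> B' \<and> a' \<in> B' \<and> a \<ominus> a' \<in> I\<^sub>1"
proof -
  \<comment> \<open>Because \<open>a [^] p\<close> lies in \<open>B\<close>, subtracting it as a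
    constant gives a monic relation of degree \<open>p\<close>. This bounds the minimal
    degree.\<close>
  have "\<ominus> (a [^] p) \<in> pspan B p a"
    using pspan_const[OF coeff_subring_subring a residue_char_pos] subringE(5)[OF coeff_subring_subring] coeff_subring_pow[OF a] by blast
  then have relp: "monic_relation_degree a p"
    unfolding monic_relation_degree_def using a I\<^sub>1.zero_closed by (intro bexI[of _ "\<ominus> (a [^] p)"]) (auto simp: l_neg)
  define d where "d = (LEAST d. monic_relation_degree a d)"
  have min: "\<not> monic_relation_degree a e" if "e < d" for e
    using not_less_Least that unfolding d_def by blast
  have rel: "monic_relation_degree a d" using LeastI[of "monic_relation_degree a", OF relp] unfolding d_def .
  have "d \<le> p" using relp min by (meson not_le)
  \<comment> \<open>A relation of degree zero would put one into \<open>I\<^sub>1\<close>.\<close>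
  have "\<not> monic_relation_degree a 0"
    using I\<^sub>1.one_imp_carrier I\<^sub>1.I_notcarr by (auto simp: monic_relation_degree_def pspan_def)
  then have "d > 0" using rel by (cases d) auto
  have "\<exists>a'\<in>carrier V. a' \<ominus> a \<in> I\<^sub>1 \<and> a' [^] d \<in> pspan B d a'"
  proof (cases "d = p")
    case True
    then show ?thesis
      using a pspan_const[OF coeff_subring_subring a residue_char_pos] coeff_subring_pow[OF a] I\<^sub>1.zero_closed
      by (intro bexI[of _ a]) (auto simp: minus_eq r_neg)
  next
    case False
    then show ?thesis using newton_step[OF min a rel \<open>d > 0\<close>] \<open>d \<le> p\<close> by simp
  qed
  then obtain a' where a': "a' \<in> carrier V" "a' \<ominus> a \<in> I\<^sub>1" "a' [^] d \<in> pspan B d a'" by blast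
  have "a \<ominus> a' = \<ominus> (a' \<ominus> a)" using a a' by algebra
  then have aa': "a \<ominus> a' \<in> I\<^sub>1" using a' by (simp add: I\<^sub>1.a_inv_closed)
  then have "\<not> monic_relation_degree a' e" if "e < d" for e
    using monic_relation_degree_cong[of a' e a] min[OF that] a a' by blast
  then have "coeff_subring (pspan B d a')" using coeff_subring_pspan a' \<open>d > 0\<close> by blast
  moreover have "B \<subseteq> pspan B d a'" using pspan_const[OF coeff_subring_subring a'(1) \<open>d > 0\<close>] by blast
  moreover have "a' \<in> pspan B d a'"
    using pspan_mult_var[OF coeff_subring_subring a'(1,3) pspan_const[OF coeff_subring_subring a'(1) \<open>d > 0\<close> subringE(3)[OF coeff_subring_subring]]] a'
    by simp
  ultimately show ?thesis using aa' by blast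
qed

end

lemma ex_coefficient_ring:
  "\<exists>B. coeff_subring B \<and> (\<forall>a\<in>carrier V. \<exists>w\<in>carrier V. a \<ominus> \<pi> \<otimes> w \<in> B)"
proof -
  obtain B where B: "coeff_subring B" "\<And>B'. coeff_subring B' \<Longrightarrow> B \<subseteq> B' \<Longrightarrow> B' = B"
    using ex_maximal_coeff_subring by blast
  have "\<exists>w\<in>carrier V. a \<ominus> \<pi> \<otimes> w \<in> B" if a: "a \<in> carrier V" for a
  proof -
    obtain a' where a': "a' \<in> B" "a \<ominus> a' \<in> I\<^sub>1"
      using coeff_subring_extend[OF B(1) a] B(2) by metis
    then obtain w where w: "w \<in> carrier V" "a \<ominus> a' = \<pi> \<otimes> w" unfolding mem_I\<^sub>1 by blast
    have "a' \<in> carrier V" using a' coeff_subring_carrier[OF B(1)] by blast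
    then have "a \<ominus> (a \<ominus> a') = a'" using a by algebra
    then show ?thesis using w a' by auto
  qed
  then show ?thesis using B(1) by blast
qed

text \<open>\<open>\<delta> v\<close> is the coefficient of \<open>\<pi>\<close> in a decomposition
  of \<open>v\<close> into an element of \<open>B\<close> and a multiple of \<open>\<pi>\<close>. It
  is unique modulo \<open>I\<^sub>1\<close>, so each congruence follows once its two sides are seen
  to be admissible coefficients for the same element.\<close>

lemma ex_derivation_mod_uniformizer:
  "\<exists>\<delta>. \<delta> \<in> carrier V \<rightarrow> carrier V \<and> \<delta> \<zero> = \<zero> \<and> \<delta> \<pi> \<ominus> \<one> \<in> I\<^sub>1 \<and>
    (\<forall>v\<in>carrier V. \<forall>w\<in>carrier V. \<delta> (v \<oplus> w) \<ominus> (\<delta> v \<oplus> \<delta> w) \<in> I\<^sub>1) \<and>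
    (\<forall>v\<in>carrier V. \<forall>w\<in>carrier V. \<delta> (v \<otimes> w) \<ominus> (v \<otimes> \<delta> w \<oplus> w \<otimes> \<delta> v) \<in> I\<^sub>1)"
proof -
  obtain B where B: "coeff_subring B"
    and "\<forall>a\<in>carrier V. \<exists>w\<in>carrier V. a \<ominus> \<pi> \<otimes> w \<in> B" using ex_coefficient_ring by blast
  then obtain \<delta>\<^sub>0 where \<delta>\<^sub>0: "\<And>a. a \<in> carrier V \<Longrightarrow> \<delta>\<^sub>0 a \<in> carrier V \<and> a \<ominus> \<pi> \<otimes> \<delta>\<^sub>0 a \<in> B"
    by metis
  \<comment> \<open>The coefficients are chosen arbitrarily, but the value at zero is fixed exactly:
    applying \<open>\<delta>\<close> to the coefficients of a polynomial must keep the support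
    finite.\<close>
  define \<delta> where "\<delta> v = (if v = \<zero> then \<zero> else \<delta>\<^sub>0 v)" for v
  note sub = coeff_subring_subring[OF B] and pc = uniformizer_closed
  have \<delta>: "\<delta> a \<in> carrier V" "a \<ominus> \<pi> \<otimes> \<delta> a \<in> B" if "a \<in> carrier V" for a
    using \<delta>\<^sub>0[OF that] pc subringE(2)[OF sub] by (auto simp: \<delta>_def minus_eq)
  have uniq: "x \<ominus> y \<in> I\<^sub>1"
    if "v \<in> carrier V" "x \<in> carrier V" "y \<in> carrier V" "v \<ominus> \<pi> \<otimes> x \<in> B" "v \<ominus> \<pi> \<otimes> y \<in> B" for v x y
  proof -
    \<comment> \<open>The difference of the two \<open>B\<close>-components lies in \<open>B\<close>
      and in \<open>I\<^sub>1\<close>, hence in \<open>I\<^sub>2\<close>, where one factor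
      \<open>\<pi>\<close> can be cancelled.\<close>
    have "\<pi> \<otimes> (x \<ominus> y) = (v \<ominus> \<pi> \<otimes> y) \<oplus> \<ominus> (v \<ominus> \<pi> \<otimes> x)" using that(1-3) pc by algebra
    then have "\<pi> \<otimes> (x \<ominus> y) \<in> B" using that(4,5) subringE(5,7)[OF sub] by simp
    then have "\<pi> \<otimes> (x \<ominus> y) \<in> I\<^sub>2"
      using coeff_subring_Int[OF B] that mem_I\<^sub>1 by blast
    then show ?thesis using that by (intro uniformizer_mult_mem_I\<^sub>2) auto
  qed
  have "\<delta> \<pi> \<ominus> \<one> \<in> I\<^sub>1"
    using pc \<delta> subringE(2)[OF sub] by (intro uniq[of \<pi>]) (auto simp: minus_eq r_neg)
  moreover have "\<delta> (v \<oplus> w) \<ominus> (\<delta> v \<oplus> \<delta> w) \<in> I\<^sub>1" if vw: "v \<in> carrier V" "w \<in> carrier V" for v w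
  proof (rule uniq)
    have "v \<oplus> w \<ominus> \<pi> \<otimes> (\<delta> v \<oplus> \<delta> w) = (v \<ominus> \<pi> \<otimes> \<delta> v) \<oplus> (w \<ominus> \<pi> \<otimes> \<delta> w)"
      using pc vw \<delta>(1)[OF vw(1)] \<delta>(1)[OF vw(2)] by algebra
    then show "v \<oplus> w \<ominus> \<pi> \<otimes> (\<delta> v \<oplus> \<delta> w) \<in> B"
      using \<delta>(2)[OF vw(1)] \<delta>(2)[OF vw(2)] subringE(7)[OF sub] by simp
  qed (use vw \<delta> in auto)
  moreover have "\<delta> (v \<otimes> w) \<ominus> (v \<otimes> \<delta> w \<oplus> w \<otimes> \<delta> v) \<in> I\<^sub>1"
    if vw: "v \<in> carrier V" "w \<in> carrier V" for v w
  proof (rule uniq)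
    have cl: "\<delta> v \<in> carrier V" "\<delta> w \<in> carrier V" using \<delta> vw by auto
    \<comment> \<open>Multiplying the two decompositions gives the Leibniz term up to a multiple of
      the square of \<open>\<pi>\<close>, and \<open>B\<close> contains
      \<open>I\<^sub>2\<close>.\<close>
    have "v \<otimes> w \<ominus> \<pi> \<otimes> (v \<otimes> \<delta> w \<oplus> w \<otimes> \<delta> v)
        = (v \<ominus> \<pi> \<otimes> \<delta> v) \<otimes> (w \<ominus> \<pi> \<otimes> \<delta> w) \<oplus> \<ominus> (\<pi> \<otimes> \<pi> \<otimes> (\<delta> v \<otimes> \<delta> w))"
      using pc vw cl by algebra
    moreover have "\<pi> \<otimes> \<pi> \<otimes> (\<delta> v \<otimes> \<delta> w) \<in> B"
      using coeff_subring_I\<^sub>2[OF B] cgenideal_self[of "\<pi> \<otimes> \<pi>"] cl pc I\<^sub>2.I_r_closed by blast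
    ultimately show "v \<otimes> w \<ominus> \<pi> \<otimes> (v \<otimes> \<delta> w \<oplus> w \<otimes> \<delta> v) \<in> B"
      using \<delta>(2)[OF vw(1)] \<delta>(2)[OF vw(2)] subringE(5-7)[OF sub] by simp
  qed (use vw \<delta> in auto)
  ultimately show ?thesis using \<delta>(1) by (intro exI[of _ \<delta>]) (auto simp: \<delta>_def)
qed

end

section \<open>Multivariate polynomial rings\<close>

lemma finite_Collect_subseteq_mset [simp]: "finite {a. a \<subseteq># m}"
proof (induction m)
  case (add x m)
  have "{a. a \<subseteq># add_mset x m} \<subseteq> {a. a \<subseteq># m} \<union> add_mset x ` {a. a \<subseteq># m}"
  proof
    fix a assume "a \<in> {a. a \<subseteq># add_mset x m}"
    then have a: "a \<subseteq># add_mset x m" by simp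
    show "a \<in> {a. a \<subseteq># m} \<union> add_mset x ` {a. a \<subseteq># m}"
    proof (cases "x \<in># a")
      case True
      then obtain b where "a = add_mset x b" by (metis insert_DiffM)
      then show ?thesis using a by auto
    next
      case False
      then show ?thesis using a subset_eq_diff_conv[of a "{#x#}" m] by (simp add: diff_single_trivial)
    qed
  qed
  then show ?case using add finite_subset by blast
qed simp

context cring
begin

text \<open>A monomial has only finitely many factorizations, so the product makes sense for all
  coefficient functions, and several of its laws need only \<open>carrier_coeff\<close>.\<close>

definition mpoly_mult where
  "mpoly_mult P Q m = (\<Oplus>a\<in>{a. a \<subseteq># m}. P a \<otimes> Q (m - a))"

lemma mpoly_ring_simps:
  "carrier (mpoly_ring R n) = indexed_pset {1..n} (carrier R)"
  "P \<otimes>\<^bsub>mpoly_ring R n\<^esub> Q = mpoly_mult P Q"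
  "\<one>\<^bsub>mpoly_ring R n\<^esub> = indexed_const \<one>"
  "\<zero>\<^bsub>mpoly_ring R n\<^esub> = indexed_const \<zero>"
  "P \<oplus>\<^bsub>mpoly_ring R n\<^esub> Q = indexed_padd P Q"
  by (simp_all add: mpoly_ring_def mpoly_mult_def[abs_def])

lemma mpoly_mult_closed: "carrier_coeff P \<Longrightarrow> carrier_coeff Q \<Longrightarrow> carrier_coeff (mpoly_mult P Q)"
  by (auto simp: carrier_coeff_def mpoly_mult_def intro!: finsum_closed)

text \<open>The map sending a factor of \<open>m\<close> to its complementary factor is an
  involution and reindexes the sum.\<close>

lemma mpoly_mult_comm:
  fixes P Q :: "'c multiset \<Rightarrow> 'a"
  assumes "carrier_coeff P" "carrier_coeff Q"
  shows "mpoly_mult P Q = mpoly_mult Q P"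
proof
  fix m :: "'c multiset"
  have "bij_betw (\<lambda>a. m - a) {a. a \<subseteq># m} {a. a \<subseteq># m}"
    by (rule bij_betw_byWitness[where f' = "\<lambda>a. m - a"])
      (auto simp: subset_mset.diff_diff_right)
  then have bij: "inj_on (\<lambda>a. m - a) {a. a \<subseteq># m}" "(\<lambda>a. m - a) ` {a. a \<subseteq># m} = {a. a \<subseteq># m}"
    by (auto simp: bij_betw_def)
  have "mpoly_mult P Q m = (\<Oplus>a\<in>(\<lambda>a. m - a) ` {a. a \<subseteq># m}. P a \<otimes> Q (m - a))"
    unfolding mpoly_mult_def bij(2) ..
  also have "\<dots> = (\<Oplus>a\<in>{a. a \<subseteq># m}. P (m - a) \<otimes> Q (m - (m - a)))"
    using assms by (intro finsum_reindex[OF _ bij(1)]) (auto simp: carrier_coeff_def)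
  also have "\<dots> = mpoly_mult Q P m"
    unfolding mpoly_mult_def using assms
    by (intro finsum_cong') (auto simp: carrier_coeff_def m_comm subset_mset.diff_diff_right)
  finally show "mpoly_mult P Q m = mpoly_mult Q P m" .
qed

lemma mpoly_mult_padd:
  assumes "carrier_coeff P" "carrier_coeff P'" "carrier_coeff Q"
  shows "mpoly_mult (P \<Oplus> P') Q = mpoly_mult P Q \<Oplus> mpoly_mult P' Q"
proof
  fix m
  have "mpoly_mult (P \<Oplus> P') Q m = (\<Oplus>a\<in>{a. a \<subseteq># m}. P a \<otimes> Q (m - a) \<oplus> P' a \<otimes> Q (m - a))"
    using assms unfolding mpoly_mult_def
    by (intro finsum_cong') (auto simp: indexed_padd_def carrier_coeff_def l_distr)
  also have "\<dots> = (mpoly_mult P Q \<Oplus> mpoly_mult P' Q) m"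
    using assms unfolding mpoly_mult_def indexed_padd_def
    by (intro finsum_addf) (auto simp: carrier_coeff_def)
  finally show "mpoly_mult (P \<Oplus> P') Q m = (mpoly_mult P Q \<Oplus> mpoly_mult P' Q) m" .
qed

lemma mpoly_mult_const:
  assumes "k \<in> carrier R" "carrier_coeff Q"
  shows "mpoly_mult (indexed_const k) Q = (\<lambda>m. k \<otimes> Q m)"
proof
  fix m
  have "mpoly_mult (indexed_const k) Q m = (\<Oplus>a\<in>{a. a \<subseteq># m}. if {#} = a then k \<otimes> Q (m - a) else \<zero>)"
    using assms unfolding mpoly_mult_def
    by (intro finsum_cong') (auto simp: carrier_coeff_def indexed_const_def)
  also have "\<dots> = k \<otimes> Q m"
    using assms by (subst finsum_singleton) (auto simp: carrier_coeff_def)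
  finally show "mpoly_mult (indexed_const k) Q m = k \<otimes> Q m" .
qed

text \<open>Only the factors \<open>a\<close> containing the variable \<open>i\<close> contribute,
  and removing one \<open>i\<close> matches them with the factors of \<open>m - {#i#}\<close>.
  Together with the laws for sums and constants this covers all constructors of
  \<open>indexed_pset\<close>.\<close>

lemma mpoly_mult_pmult:
  assumes "carrier_coeff P" "carrier_coeff Q"
  shows "mpoly_mult (P \<Otimes> i) Q = mpoly_mult P Q \<Otimes> i"
proof
  fix m
  let ?g = "\<lambda>a. (P \<Otimes> i) a \<otimes> Q (m - a)"
  have g: "?g a \<in> carrier R" for a
    using assms indexed_pmult_in_carrier[of P i] by (auto simp: carrier_coeff_def)
  show "mpoly_mult (P \<Otimes> i) Q m = (mpoly_mult P Q \<Otimes> i) m"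
  proof (cases "i \<in># m")
    case True
    let ?A = "add_mset i ` {a. a \<subseteq># m - {#i#}}"
    have "mpoly_mult (P \<Otimes> i) Q m = finsum R ?g ?A"
      unfolding mpoly_mult_def
    proof (rule add.finprod_mono_neutral_cong_right)
      show "?A \<subseteq> {a. a \<subseteq># m}"
        using True by (auto simp: insert_subset_eq_iff)
      show "?g a = \<zero>" if "a \<in> {a. a \<subseteq># m} - ?A" for a
      proof -
        have "i \<notin># a"
        proof
          assume "i \<in># a"
          then obtain b where "a = add_mset i b" by (metis insert_DiffM)
          then show False using that by (auto simp: insert_subset_eq_iff)
        qed
        then show ?thesis using assms by (simp add: indexed_pmult_def carrier_coeff_def)
      qed
    qed (use g in auto)
    also have "\<dots> = (\<Oplus>a\<in>{a. a \<subseteq># m - {#i#}}. ?g (add_mset i a))"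
      using g by (intro finsum_reindex) (auto simp: inj_on_def)
    also have "\<dots> = mpoly_mult P Q (m - {#i#})"
      unfolding mpoly_mult_def using assms
      by (intro finsum_cong') (auto simp: indexed_pmult_def carrier_coeff_def)
    finally show ?thesis using True by (simp add: indexed_pmult_def)
  next
    case False
    then have "?g a = \<zero>" if "a \<subseteq># m" for a
      using that mset_subset_eqD[of a m i] assms by (auto simp: indexed_pmult_def carrier_coeff_def)
    then have "mpoly_mult (P \<Otimes> i) Q m = (\<Oplus>a\<in>{a. a \<subseteq># m}. \<zero>)"
      unfolding mpoly_mult_def by (intro finsum_cong') auto
    then show ?thesis using False by (simp add: indexed_pmult_def)
  qed
qed

lemma indexed_pset_carrier_coeff: "P \<in> indexed_pset I (carrier R) \<Longrightarrow> carrier_coeff P"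
  by (rule indexed_pset_in_carrier) auto

lemma indexed_pset_smult:
  fixes P :: "'c multiset \<Rightarrow> 'a"
  assumes "k \<in> carrier R" "P \<in> indexed_pset I (carrier R)"
  shows "(\<lambda>m. k \<otimes> P m) \<in> indexed_pset I (carrier R)"
  using assms(2)
proof (induction rule: indexed_pset.induct)
  case (indexed_const c)
  have "(\<lambda>m :: 'c multiset. k \<otimes> indexed_const c m) = indexed_const (k \<otimes> c)"
    using assms by (auto simp: indexed_const_def)
  then show ?case using assms indexed_const by (auto intro: indexed_pset.indexed_const)
next
  case (indexed_padd P Q)
  then have "(\<lambda>m. k \<otimes> (P \<Oplus> Q) m) = (\<lambda>m. k \<otimes> P m) \<Oplus> (\<lambda>m. k \<otimes> Q m)"
    using assms indexed_pset_carrier_coeff[OF indexed_padd(1)] indexed_pset_carrier_coeff[OF indexed_padd(2)]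
    by (simp add: indexed_padd_def carrier_coeff_def r_distr)
  then show ?case using indexed_padd by (auto intro: indexed_pset.indexed_padd)
next
  case (indexed_pmult P i)
  have "(\<lambda>m. k \<otimes> (P \<Otimes> i) m) = (\<lambda>m. k \<otimes> P m) \<Otimes> i"
    using assms by (auto simp: indexed_pmult_def)
  then show ?case using indexed_pmult by (auto intro: indexed_pset.indexed_pmult)
qed

lemma indexed_pset_mult:
  assumes "P \<in> indexed_pset I (carrier R)" "Q \<in> indexed_pset I (carrier R)"
  shows "mpoly_mult P Q \<in> indexed_pset I (carrier R)"
  using assms
proof (induction rule: indexed_pset.induct)
  case (indexed_const k)
  then show ?case by (simp add: mpoly_mult_const indexed_pset_carrier_coeff indexed_pset_smult)
next
  case (indexed_padd P P')
  then show ?case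
    by (simp add: mpoly_mult_padd indexed_pset_carrier_coeff indexed_pset.indexed_padd)
next
  case (indexed_pmult P i)
  then show ?case
    by (simp add: mpoly_mult_pmult indexed_pset_carrier_coeff indexed_pset.indexed_pmult)
qed

text \<open>Induction over the construction of \<open>P\<close> replaces the reindexing of a double
  sum.\<close>

lemma mpoly_mult_assoc:
  assumes P: "P \<in> indexed_pset I (carrier R)" and Q: "carrier_coeff Q" and T: "carrier_coeff T"
  shows "mpoly_mult (mpoly_mult P Q) T = mpoly_mult P (mpoly_mult Q T)"
  using P
proof (induction rule: indexed_pset.induct)
  case (indexed_const k)
  have "mpoly_mult (\<lambda>m. k \<otimes> Q m) T = (\<lambda>m. k \<otimes> mpoly_mult Q T m)"
  proof
    fix m
    have "mpoly_mult (\<lambda>m. k \<otimes> Q m) T m = (\<Oplus>a\<in>{a. a \<subseteq># m}. k \<otimes> (Q a \<otimes> T (m - a)))"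
      using Q T indexed_const unfolding mpoly_mult_def
      by (intro finsum_cong') (auto simp: carrier_coeff_def m_assoc)
    also have "\<dots> = k \<otimes> mpoly_mult Q T m"
      using Q T indexed_const unfolding mpoly_mult_def
      by (intro finsum_rdistr[symmetric]) (auto simp: carrier_coeff_def)
    finally show "mpoly_mult (\<lambda>m. k \<otimes> Q m) T m = k \<otimes> mpoly_mult Q T m" .
  qed
  then show ?case using indexed_const Q T by (simp add: mpoly_mult_const mpoly_mult_closed)
next
  case (indexed_padd P P')
  then show ?case
    using Q T by (simp add: mpoly_mult_padd indexed_pset_carrier_coeff mpoly_mult_closed)
next
  case (indexed_pmult P i)
  then show ?case
    using Q T by (simp add: mpoly_mult_pmult indexed_pset_carrier_coeff mpoly_mult_closed)
qed

lemma mpoly_ring_is_cring: "cring (mpoly_ring R n)"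
proof (rule cringI)
  let ?I = "{1..n}"
  note cc = indexed_pset_carrier_coeff[of _ "?I"]
  show "abelian_group (mpoly_ring R n)"
  proof (rule abelian_groupI)
    fix P assume "P \<in> carrier (mpoly_ring R n)"
    then have P: "P \<in> indexed_pset ?I (carrier R)" by (simp add: mpoly_ring_simps)
    have "(\<lambda>m. \<ominus> \<one> \<otimes> P m) \<in> indexed_pset ?I (carrier R)"
      by (rule indexed_pset_smult[OF _ P]) simp
    moreover have "(\<lambda>m. \<ominus> \<one> \<otimes> P m) \<Oplus> P = indexed_const \<zero>"
      using cc[OF P] by (auto simp: indexed_padd_def indexed_zero_def carrier_coeff_def l_minus l_neg)
    ultimately show "\<exists>Q\<in>carrier (mpoly_ring R n). Q \<oplus>\<^bsub>mpoly_ring R n\<^esub> P = \<zero>\<^bsub>mpoly_ring R n\<^esub>"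
      by (auto simp: mpoly_ring_simps)
  next
    fix P Q T
    assume "P \<in> carrier (mpoly_ring R n)" "Q \<in> carrier (mpoly_ring R n)" "T \<in> carrier (mpoly_ring R n)"
    then have "carrier_coeff P" "carrier_coeff Q" "carrier_coeff T" using cc by (simp_all add: mpoly_ring_simps)
    then show "P \<oplus>\<^bsub>mpoly_ring R n\<^esub> Q \<oplus>\<^bsub>mpoly_ring R n\<^esub> T
        = P \<oplus>\<^bsub>mpoly_ring R n\<^esub> (Q \<oplus>\<^bsub>mpoly_ring R n\<^esub> T)"
      "P \<oplus>\<^bsub>mpoly_ring R n\<^esub> Q = Q \<oplus>\<^bsub>mpoly_ring R n\<^esub> P"
      "\<zero>\<^bsub>mpoly_ring R n\<^esub> \<oplus>\<^bsub>mpoly_ring R n\<^esub> P = P"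
      by (simp_all add: mpoly_ring_simps indexed_padd_zero)
        (simp_all add: indexed_padd_def carrier_coeff_def a_ac)
  qed (auto simp: mpoly_ring_simps intro: indexed_pset.indexed_padd indexed_pset.indexed_const)
  show "comm_monoid (mpoly_ring R n)"
  proof (rule comm_monoidI)
    fix P Q T
    assume "P \<in> carrier (mpoly_ring R n)" "Q \<in> carrier (mpoly_ring R n)" "T \<in> carrier (mpoly_ring R n)"
    then show "P \<otimes>\<^bsub>mpoly_ring R n\<^esub> Q \<otimes>\<^bsub>mpoly_ring R n\<^esub> T
        = P \<otimes>\<^bsub>mpoly_ring R n\<^esub> (Q \<otimes>\<^bsub>mpoly_ring R n\<^esub> T)"
      using mpoly_mult_assoc[of P "?I"] cc by (simp add: mpoly_ring_simps)
  next
    fix P assume "P \<in> carrier (mpoly_ring R n)"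
    then have "carrier_coeff P" using cc by (simp add: mpoly_ring_simps)
    then show "\<one>\<^bsub>mpoly_ring R n\<^esub> \<otimes>\<^bsub>mpoly_ring R n\<^esub> P = P"
      by (simp add: mpoly_ring_simps mpoly_mult_const) (simp add: carrier_coeff_def)
  next
    fix P Q assume "P \<in> carrier (mpoly_ring R n)" "Q \<in> carrier (mpoly_ring R n)"
    then show "P \<otimes>\<^bsub>mpoly_ring R n\<^esub> Q = Q \<otimes>\<^bsub>mpoly_ring R n\<^esub> P"
      using mpoly_mult_comm[OF cc cc] by (simp add: mpoly_ring_simps)
  qed (auto simp: mpoly_ring_simps indexed_pset_mult intro: indexed_pset.indexed_const)
  fix P Q T
  assume "P \<in> carrier (mpoly_ring R n)" "Q \<in> carrier (mpoly_ring R n)" "T \<in> carrier (mpoly_ring R n)"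
  then show "(P \<oplus>\<^bsub>mpoly_ring R n\<^esub> Q) \<otimes>\<^bsub>mpoly_ring R n\<^esub> T
      = P \<otimes>\<^bsub>mpoly_ring R n\<^esub> T \<oplus>\<^bsub>mpoly_ring R n\<^esub> Q \<otimes>\<^bsub>mpoly_ring R n\<^esub> T"
    using mpoly_mult_padd[OF cc cc cc] by (simp add: mpoly_ring_simps)
qed

text \<open>A description by finite support is what coefficientwise operations require: a map such
  as \<open>\<delta>\<close> need not respect the constructors of
  \<open>indexed_pset\<close>.\<close>

lemma indexed_pset_iff:
  "P \<in> indexed_pset I (carrier R) \<longleftrightarrow>
    carrier_coeff P \<and> finite {m. P m \<noteq> \<zero>} \<and> (\<forall>m. P m \<noteq> \<zero> \<longrightarrow> set_mset m \<subseteq> I)"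
proof
  assume "P \<in> indexed_pset I (carrier R)"
  then show "carrier_coeff P \<and> finite {m. P m \<noteq> \<zero>} \<and> (\<forall>m. P m \<noteq> \<zero> \<longrightarrow> set_mset m \<subseteq> I)"
  proof (induction rule: indexed_pset.induct)
    case (indexed_const k)
    have "{m. indexed_const k m \<noteq> \<zero>} \<subseteq> {{#}}" by (auto simp: indexed_const_def)
    then show ?case
      using indexed_const finite_subset by (auto simp: indexed_const_def carrier_coeff_def)
  next
    case (indexed_padd P Q)
    have sub: "{m. (P \<Oplus> Q) m \<noteq> \<zero>} \<subseteq> {m. P m \<noteq> \<zero>} \<union> {m. Q m \<noteq> \<zero>}"
      by (auto simp: indexed_padd_def)
    then have "finite {m. (P \<Oplus> Q) m \<noteq> \<zero>}"
      using indexed_padd by (meson finite_UnI finite_subset)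
    then show ?case using indexed_padd sub indexed_padd_in_carrier by blast
  next
    case (indexed_pmult P i)
    have sub: "{m. (P \<Otimes> i) m \<noteq> \<zero>} \<subseteq> add_mset i ` {m. P m \<noteq> \<zero>}"
    proof
      fix m assume "m \<in> {m. (P \<Otimes> i) m \<noteq> \<zero>}"
      then have "i \<in># m" "P (m - {#i#}) \<noteq> \<zero>" by (auto simp: indexed_pmult_def split: if_splits)
      then show "m \<in> add_mset i ` {m. P m \<noteq> \<zero>}"
        by (intro image_eqI[of _ _ "m - {#i#}"]) auto
    qed
    then have "finite {m. (P \<Otimes> i) m \<noteq> \<zero>}"
      using indexed_pmult by (meson finite_imageI finite_subset)
    then show ?case using indexed_pmult sub indexed_pmult_in_carrier by fastforce
  qed
next
  have monomial: "(\<lambda>m'. if m' = m then k else \<zero>) \<in> indexed_pset I (carrier R)"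
    if "k \<in> carrier R" "set_mset m \<subseteq> I" for m k
    using that(2)
  proof (induction m)
    case empty
    then show ?case using indexed_pset.indexed_const[of k "carrier R" I] that(1)
      by (simp add: indexed_const_def)
  next
    case (add i m)
    have "(\<lambda>m'. if m' = add_mset i m then k else \<zero>) = (\<lambda>m'. if m' = m then k else \<zero>) \<Otimes> i"
      by (auto simp: indexed_pmult_def fun_eq_iff)
    then show ?case using add by (auto intro: indexed_pset.indexed_pmult)
  qed
  assume P: "carrier_coeff P \<and> finite {m. P m \<noteq> \<zero>} \<and> (\<forall>m. P m \<noteq> \<zero> \<longrightarrow> set_mset m \<subseteq> I)"
  \<comment> \<open>\<open>P\<close> is assembled from its finite support, one monomial at a
    time.\<close>
  have "(\<lambda>m. if m \<in> F then P m else \<zero>) \<in> indexed_pset I (carrier R)"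
    if "finite F" "F \<subseteq> {m. P m \<noteq> \<zero>}" for F
    using that
  proof (induction F rule: finite_induct)
    case empty
    then show ?case using indexed_pset.indexed_const[of \<zero> "carrier R" I]
      by (simp add: indexed_zero_def)
  next
    case (insert x F)
    have "(\<lambda>m. if m \<in> insert x F then P m else \<zero>)
        = (\<lambda>m. if m = x then P x else \<zero>) \<Oplus> (\<lambda>m. if m \<in> F then P m else \<zero>)"
      using insert P by (auto simp: indexed_padd_def fun_eq_iff carrier_coeff_def)
    moreover have "(\<lambda>m. if m = x then P x else \<zero>) \<in> indexed_pset I (carrier R)"
      using monomial[of "P x" x] insert P by (auto simp: carrier_coeff_def)
    ultimately show ?case using insert by (auto intro: indexed_pset.indexed_padd)
  qed
  from this[of "{m. P m \<noteq> \<zero>}"] have "(\<lambda>m. if P m \<noteq> \<zero> then P m else \<zero>) \<in> indexed_pset I (carrier R)"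
    using P by simp
  moreover have "(\<lambda>m. if P m \<noteq> \<zero> then P m else \<zero>) = P" by auto
  ultimately show "P \<in> indexed_pset I (carrier R)" by simp
qed

lemma mem_PIdl_indexed_const:
  assumes "P \<in> indexed_pset {1..n} (carrier R)" "x \<in> carrier R" "\<And>m. P m \<in> PIdl x"
  shows "P \<in> PIdl\<^bsub>mpoly_ring R n\<^esub> (indexed_const x)"
proof -
  have "\<forall>m. \<exists>q\<in>carrier R. P m = q \<otimes> x" using assms(3) unfolding cgenideal_def by blast
  then obtain q where q: "\<And>m. q m \<in> carrier R" "\<And>m. P m = q m \<otimes> x" by metis
  \<comment> \<open>The quotients of the coefficients by \<open>x\<close> are arbitrary choices;
    resetting them to zero where \<open>P\<close> vanishes keeps the support of \<open>Q\<close>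
    within that of \<open>P\<close>.\<close>
  define Q where "Q m = (if P m = \<zero> then \<zero> else q m)" for m
  have Q: "carrier_coeff Q" using q by (auto simp: Q_def carrier_coeff_def)
  have "{m. Q m \<noteq> \<zero>} \<subseteq> {m. P m \<noteq> \<zero>}" by (auto simp: Q_def)
  then have "Q \<in> indexed_pset {1..n} (carrier R)"
    using assms(1) Q finite_subset unfolding indexed_pset_iff by blast
  moreover have "P = mpoly_mult Q (indexed_const x)"
  proof -
    have "mpoly_mult Q (indexed_const x) = mpoly_mult (indexed_const x) Q"
      using Q assms(2) by (intro mpoly_mult_comm) (auto simp: carrier_coeff_def indexed_const_def)
    also have "\<dots> = P"
      using Q q(1) assms(2) by (auto simp: mpoly_mult_const Q_def fun_eq_iff q(2) m_comm)
    finally show ?thesis by simp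
  qed
  ultimately show ?thesis unfolding cgenideal_def by (auto simp: mpoly_ring_simps)
qed

end

section \<open>Quotient modules and derivations acting on coefficients\<close>

lemma (in cring) quot_module_is_module:
  assumes "ideal I R"
  shows "module R (quot_module R I)"
proof -
  interpret I: ideal I R by fact
  interpret Q: cring "R Quot I" using I.quotient_is_cring is_cring by blast
  interpret h: ring_hom_ring R "R Quot I" "(+>) I" by (rule I.rcos_ring_hom_ring)
  have simps: "carrier (quot_module R I) = carrier (R Quot I)"
    "add (quot_module R I) = add (R Quot I)" "ring.zero (quot_module R I) = ring.zero (R Quot I)"
    "smult (quot_module R I) = (\<lambda>r x. (I +> r) \<otimes>\<^bsub>R Quot I\<^esub> x)"
    by (simp_all add: quot_module_def ring.defs)
  have "abelian_group (quot_module R I)"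
    by (rule abelian_groupI) (auto simp: simps Q.a_ac intro: Q.add.inv_closed Q.l_neg)
  then show ?thesis
  proof (rule moduleI[OF is_cring], unfold simps)
    show "(I +> a) \<otimes>\<^bsub>R Quot I\<^esub> x \<in> carrier (R Quot I)"
      if "a \<in> carrier R" "x \<in> carrier (R Quot I)" for a x
      using Q.m_closed[OF h.hom_closed] that .
    show "(I +> a \<oplus> b) \<otimes>\<^bsub>R Quot I\<^esub> x
        = (I +> a) \<otimes>\<^bsub>R Quot I\<^esub> x \<oplus>\<^bsub>R Quot I\<^esub> (I +> b) \<otimes>\<^bsub>R Quot I\<^esub> x"
      if "a \<in> carrier R" "b \<in> carrier R" "x \<in> carrier (R Quot I)" for a b x
      unfolding h.hom_add[OF that(1,2)] using Q.l_distr[OF h.hom_closed h.hom_closed] that .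
    show "(I +> a) \<otimes>\<^bsub>R Quot I\<^esub> (x \<oplus>\<^bsub>R Quot I\<^esub> y)
        = (I +> a) \<otimes>\<^bsub>R Quot I\<^esub> x \<oplus>\<^bsub>R Quot I\<^esub> (I +> a) \<otimes>\<^bsub>R Quot I\<^esub> y"
      if "a \<in> carrier R" "x \<in> carrier (R Quot I)" "y \<in> carrier (R Quot I)" for a x y
      by (rule Q.r_distr[OF that(2,3) h.hom_closed[OF that(1)]])
    show "(I +> a \<otimes> b) \<otimes>\<^bsub>R Quot I\<^esub> x
        = (I +> a) \<otimes>\<^bsub>R Quot I\<^esub> ((I +> b) \<otimes>\<^bsub>R Quot I\<^esub> x)"
      if "a \<in> carrier R" "b \<in> carrier R" "x \<in> carrier (R Quot I)" for a b x
      unfolding h.hom_mult[OF that(1,2)] using Q.m_assoc[OF h.hom_closed h.hom_closed] that .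
    show "(I +> \<one>) \<otimes>\<^bsub>R Quot I\<^esub> x = x" if "x \<in> carrier (R Quot I)" for x
      unfolding h.hom_one by (rule Q.l_one[OF that])
  qed
qed

context cring
begin

text \<open>This reduces equality of residue classes of polynomials to congruences between
  coefficients.\<close>

lemma rcos_mpoly_eqI:
  assumes x: "x \<in> carrier R" and P: "P \<in> carrier (mpoly_ring R n)" and Q: "Q \<in> carrier (mpoly_ring R n)"
    and PQ: "\<And>m. P m \<ominus> Q m \<in> PIdl x"
  shows "PIdl\<^bsub>mpoly_ring R n\<^esub> (indexed_const x) +>\<^bsub>mpoly_ring R n\<^esub> P
    = PIdl\<^bsub>mpoly_ring R n\<^esub> (indexed_const x) +>\<^bsub>mpoly_ring R n\<^esub> Q"
proof -
  let ?S = "mpoly_ring R n" and ?J = "PIdl\<^bsub>mpoly_ring R n\<^esub> (indexed_const x)"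
  interpret S: cring ?S by (rule mpoly_ring_is_cring)
  have "indexed_const x \<in> carrier ?S"
    using x by (auto simp: mpoly_ring_simps intro: indexed_pset.indexed_const)
  then interpret J: ideal ?J ?S by (rule S.cgenideal_ideal)
  interpret K: ideal "PIdl x" R by (rule cgenideal_ideal[OF x])
  define T where "T m = P m \<ominus> Q m" for m
  have PQc: "carrier_coeff P" "carrier_coeff Q"
    using P Q indexed_pset_carrier_coeff by (auto simp: mpoly_ring_simps)
  \<comment> \<open>Written as a sum with a multiple by minus one, the difference is visibly a
    polynomial.\<close>
  have "T = P \<Oplus> (\<lambda>m. \<ominus> \<one> \<otimes> Q m)"
    using PQc by (auto simp: T_def indexed_padd_def minus_eq l_minus carrier_coeff_def fun_eq_iff)
  then have T: "T \<in> indexed_pset {1..n} (carrier R)"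
    using P Q by (auto simp: mpoly_ring_simps intro!: indexed_pset.indexed_padd indexed_pset_smult)
  have TJ: "T \<in> ?J"
    by (rule mem_PIdl_indexed_const[OF T x]) (simp add: T_def PQ)
  have "P = T \<oplus>\<^bsub>?S\<^esub> Q"
  proof
    have "a = a \<ominus> b \<oplus> b" if "a \<in> carrier R" "b \<in> carrier R" for a b
      using that by algebra
    then show "P m = (T \<oplus>\<^bsub>?S\<^esub> Q) m" for m
      using PQc by (simp add: T_def mpoly_ring_simps indexed_padd_def carrier_coeff_def)
  qed
  then show ?thesis
    using S.a_coset_add_assoc[OF J.a_subset _ Q, of T] J.a_rcos_const[OF TJ] J.a_subset TJ
    by (simp add: subset_iff)
qed

text \<open>The values are taken modulo \<open>J\<close>, so it is enough that
  \<open>\<delta>\<close> is a derivation modulo \<open>x\<close>. Each coefficient of a product is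
  a finite sum of products, to which the congruences for \<open>\<delta>\<close> apply.\<close>

lemma Z_derivation_mpoly_coefficientwise:
  fixes n :: nat
  assumes x: "x \<in> carrier R"
    and \<delta>: "\<delta> \<in> carrier R \<rightarrow> carrier R" and \<delta>_zero: "\<delta> \<zero> = \<zero>"
    and \<delta>_add: "\<And>v w. v \<in> carrier R \<Longrightarrow> w \<in> carrier R \<Longrightarrow> \<delta> (v \<oplus> w) \<ominus> (\<delta> v \<oplus> \<delta> w) \<in> PIdl x"
    and \<delta>_mult: "\<And>v w. v \<in> carrier R \<Longrightarrow> w \<in> carrier R \<Longrightarrow>
      \<delta> (v \<otimes> w) \<ominus> (v \<otimes> \<delta> w \<oplus> w \<otimes> \<delta> v) \<in> PIdl x"
  defines "S \<equiv> mpoly_ring R n"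
  defines "J \<equiv> PIdl\<^bsub>S\<^esub> (indexed_const x)"
  shows "Z_derivation S (quot_module S J) (\<lambda>P. J +>\<^bsub>S\<^esub> (\<delta> \<circ> P))"
proof -
  interpret S: cring S unfolding S_def by (rule mpoly_ring_is_cring)
  have "indexed_const x \<in> carrier S"
    using x by (auto simp: S_def mpoly_ring_simps intro: indexed_pset.indexed_const)
  then have J: "ideal J S" unfolding J_def by (rule S.cgenideal_ideal)
  interpret J: ideal J S by (rule J)
  interpret K: ideal "PIdl x" R by (rule cgenideal_ideal[OF x])
  interpret h: ring_hom_ring S "S Quot J" "(+>\<^bsub>S\<^esub>) J" by (rule J.rcos_ring_hom_ring)
  note simps = mpoly_ring_simps[of n, folded S_def]
  note rcos_eqI = rcos_mpoly_eqI[OF x, of _ n, folded S_def, folded J_def]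
  have \<delta>c: "\<delta> v \<in> carrier R" if "v \<in> carrier R" for v using \<delta> that by auto
  have coeff: "carrier_coeff P" if "P \<in> carrier S" for P
    using that indexed_pset_carrier_coeff by (simp add: simps)
  have \<delta>P: "\<delta> \<circ> P \<in> carrier S" if P: "P \<in> carrier S" for P
  proof -
    have "{m. (\<delta> \<circ> P) m \<noteq> \<zero>} \<subseteq> {m. P m \<noteq> \<zero>}" using \<delta>_zero by auto
    moreover have "carrier_coeff (\<delta> \<circ> P)" using coeff[OF P] \<delta>c by (simp add: carrier_coeff_def)
    ultimately show ?thesis
      using P finite_subset unfolding simps indexed_pset_iff by blast
  qed
  have M: "carrier (quot_module S J) = carrier (S Quot J)"
    "add (quot_module S J) = add (S Quot J)"
    "smult (quot_module S J) = (\<lambda>r y. (J +>\<^bsub>S\<^esub> r) \<otimes>\<^bsub>S Quot J\<^esub> y)"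
    by (simp_all add: quot_module_def ring.defs)
  \<comment> \<open>Additivity holds only modulo \<open>x\<close>, so finite sums are handled by
    induction, collecting one error in \<open>PIdl x\<close> for the addition and one for the
    product.\<close>
  have leibniz_sum: "\<delta> (\<Oplus>a\<in>A. f a \<otimes> g a) \<ominus> (\<Oplus>a\<in>A. f a \<otimes> \<delta> (g a) \<oplus> g a \<otimes> \<delta> (f a)) \<in> PIdl x"
    if "finite A" "\<And>a. f a \<in> carrier R" "\<And>a. g a \<in> carrier R"
    for A :: "nat multiset set" and f g
    using that(1)
  proof (induction A rule: finite_induct)
    case empty
    then show ?case by (simp add: \<delta>_zero minus_eq)
  next
    case (insert b A)
    define e where "e a = f a \<otimes> \<delta> (g a) \<oplus> g a \<otimes> \<delta> (f a)" for a
    define s where "s = (\<Oplus>a\<in>A. f a \<otimes> g a)"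
    define t where "t = (\<Oplus>a\<in>A. e a)"
    define y where "y = f b \<otimes> g b"
    have ec: "e a \<in> carrier R" for a using that \<delta>c by (simp add: e_def)
    have cl: "s \<in> carrier R" "t \<in> carrier R" "y \<in> carrier R" "e b \<in> carrier R"
      "\<delta> s \<in> carrier R" "\<delta> y \<in> carrier R" "\<delta> (y \<oplus> s) \<in> carrier R"
      using that \<delta>c ec by (auto simp: s_def t_def y_def intro!: \<delta>c finsum_closed)
    have "\<delta> (y \<oplus> s) \<ominus> (e b \<oplus> t)
        = (\<delta> (y \<oplus> s) \<ominus> (\<delta> y \<oplus> \<delta> s)) \<oplus> ((\<delta> y \<ominus> e b) \<oplus> (\<delta> s \<ominus> t))"
    proof -
      have "u \<ominus> (E \<oplus> t) = (u \<ominus> (v \<oplus> w)) \<oplus> ((v \<ominus> E) \<oplus> (w \<ominus> t))"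
        if "u \<in> carrier R" "v \<in> carrier R" "w \<in> carrier R" "E \<in> carrier R" for u v w E
        using that cl(2) by algebra
      then show ?thesis using cl by blast
    qed
    moreover have "\<delta> s \<ominus> t \<in> PIdl x" using insert.IH by (simp add: s_def t_def e_def)
    moreover have "\<delta> y \<ominus> e b \<in> PIdl x" using \<delta>_mult that by (simp add: y_def e_def)
    ultimately have "\<delta> (y \<oplus> s) \<ominus> (e b \<oplus> t) \<in> PIdl x"
      using \<delta>_add cl by (simp add: K.a_closed)
    moreover have "(\<Oplus>a\<in>insert b A. f a \<otimes> g a) = y \<oplus> s"
      using insert.hyps that unfolding s_def y_def by (intro finsum_insert) auto
    moreover have "(\<Oplus>a\<in>insert b A. e a) = e b \<oplus> t"
      using insert.hyps ec unfolding t_def by (intro finsum_insert) auto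
    ultimately show ?case by (simp add: e_def)
  qed
  have leibniz: "\<delta> (mpoly_mult P Q m) \<ominus> (mpoly_mult P (\<delta> \<circ> Q) \<Oplus> mpoly_mult Q (\<delta> \<circ> P)) m \<in> PIdl x"
    if P: "P \<in> carrier S" and Q: "Q \<in> carrier S" for P Q m
  proof -
    note c = coeff[OF P] coeff[OF Q] coeff[OF \<delta>P[OF P]] coeff[OF \<delta>P[OF Q]]
    note c' = c[unfolded carrier_coeff_def, rule_format]
    \<comment> \<open>Commuting the second product makes both sums run over the same factor
      \<open>a\<close> of \<open>m\<close>, so that they can be merged termwise.\<close>
    have "(mpoly_mult P (\<delta> \<circ> Q) \<Oplus> mpoly_mult Q (\<delta> \<circ> P)) m
        = mpoly_mult P (\<delta> \<circ> Q) m \<oplus> mpoly_mult (\<delta> \<circ> P) Q m"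
      by (simp only: indexed_padd_def mpoly_mult_comm[OF c(2,3)])
    also have "\<dots> = (\<Oplus>a\<in>{a. a \<subseteq># m}. P a \<otimes> \<delta> (Q (m - a)) \<oplus> \<delta> (P a) \<otimes> Q (m - a))"
      unfolding mpoly_mult_def using c'
      by (subst finsum_addf) auto
    also have "\<dots> = (\<Oplus>a\<in>{a. a \<subseteq># m}. P a \<otimes> \<delta> (Q (m - a)) \<oplus> Q (m - a) \<otimes> \<delta> (P a))"
      using c' by (intro finsum_cong') (auto simp: m_comm)
    finally show ?thesis
      using leibniz_sum[of "{a. a \<subseteq># m}" P "\<lambda>a. Q (m - a)"] c'
      by (simp add: mpoly_mult_def)
  qed
  show ?thesis
  proof (intro Z_derivation.intro Z_derivation_axioms.intro, unfold M)
    show "module S (quot_module S J)" by (rule S.quot_module_is_module[OF J])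
    show "(\<lambda>P. J +>\<^bsub>S\<^esub> (\<delta> \<circ> P)) \<in> carrier S \<rightarrow> carrier (S Quot J)"
      using h.hom_closed[OF \<delta>P] by blast
    fix P Q assume P: "P \<in> carrier S" and Q: "Q \<in> carrier S"
    have "J +>\<^bsub>S\<^esub> (\<delta> \<circ> (P \<oplus>\<^bsub>S\<^esub> Q)) = J +>\<^bsub>S\<^esub> ((\<delta> \<circ> P) \<oplus>\<^bsub>S\<^esub> (\<delta> \<circ> Q))"
    proof (rule rcos_eqI)
      show "(\<delta> \<circ> (P \<oplus>\<^bsub>S\<^esub> Q)) m \<ominus> ((\<delta> \<circ> P) \<oplus>\<^bsub>S\<^esub> (\<delta> \<circ> Q)) m \<in> PIdl x" for m
        using \<delta>_add coeff[OF P] coeff[OF Q] by (simp add: simps indexed_padd_def carrier_coeff_def)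
    qed (use P Q \<delta>P in auto)
    also have "\<dots> = (J +>\<^bsub>S\<^esub> (\<delta> \<circ> P)) \<oplus>\<^bsub>S Quot J\<^esub> (J +>\<^bsub>S\<^esub> (\<delta> \<circ> Q))"
      by (rule h.hom_add[OF \<delta>P[OF P] \<delta>P[OF Q]])
    finally show "J +>\<^bsub>S\<^esub> (\<delta> \<circ> (P \<oplus>\<^bsub>S\<^esub> Q))
      = (J +>\<^bsub>S\<^esub> (\<delta> \<circ> P)) \<oplus>\<^bsub>S Quot J\<^esub> (J +>\<^bsub>S\<^esub> (\<delta> \<circ> Q))" .
    have "J +>\<^bsub>S\<^esub> (\<delta> \<circ> (P \<otimes>\<^bsub>S\<^esub> Q))
        = J +>\<^bsub>S\<^esub> (P \<otimes>\<^bsub>S\<^esub> (\<delta> \<circ> Q) \<oplus>\<^bsub>S\<^esub> Q \<otimes>\<^bsub>S\<^esub> (\<delta> \<circ> P))"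
    proof (rule rcos_eqI)
      show "(\<delta> \<circ> (P \<otimes>\<^bsub>S\<^esub> Q)) m \<ominus> (P \<otimes>\<^bsub>S\<^esub> (\<delta> \<circ> Q) \<oplus>\<^bsub>S\<^esub> Q \<otimes>\<^bsub>S\<^esub> (\<delta> \<circ> P)) m \<in> PIdl x" for m
        using leibniz[OF P Q] by (simp add: simps)
    qed (use P Q \<delta>P in auto)
    also have "\<dots> = (J +>\<^bsub>S\<^esub> P) \<otimes>\<^bsub>S Quot J\<^esub> (J +>\<^bsub>S\<^esub> (\<delta> \<circ> Q))
        \<oplus>\<^bsub>S Quot J\<^esub> (J +>\<^bsub>S\<^esub> Q) \<otimes>\<^bsub>S Quot J\<^esub> (J +>\<^bsub>S\<^esub> (\<delta> \<circ> P))"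
      using h.hom_add[OF S.m_closed[OF P \<delta>P[OF Q]] S.m_closed[OF Q \<delta>P[OF P]]]
      by (simp only: h.hom_mult[OF P \<delta>P[OF Q]] h.hom_mult[OF Q \<delta>P[OF P]])
    finally show "J +>\<^bsub>S\<^esub> (\<delta> \<circ> (P \<otimes>\<^bsub>S\<^esub> Q))
      = (J +>\<^bsub>S\<^esub> P) \<otimes>\<^bsub>S Quot J\<^esub> (J +>\<^bsub>S\<^esub> (\<delta> \<circ> Q))
        \<oplus>\<^bsub>S Quot J\<^esub> (J +>\<^bsub>S\<^esub> Q) \<otimes>\<^bsub>S Quot J\<^esub> (J +>\<^bsub>S\<^esub> (\<delta> \<circ> P))" .
  qed
qed

end

theorem corollary2p4:
  fixes V :: "('a, 'b) ring_scheme" and \<pi> :: 'a and p n :: nat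
  assumes "ramified_dvr V \<pi> p"
  shows "let S = mpoly_ring V n;
             \<pi>\<^sub>S = ring.indexed_const V \<pi>;
             S' = quot_module S (PIdl\<^bsub>S\<^esub> \<pi>\<^sub>S)
         in \<exists>d. Z_derivation S S' d \<and> d \<pi>\<^sub>S = \<one>\<^bsub>S'\<^esub>"
proof -
  interpret ramified_dvr V \<pi> p by fact
  obtain \<delta> where \<delta>: "\<delta> \<in> carrier V \<rightarrow> carrier V" "\<delta> \<zero>\<^bsub>V\<^esub> = \<zero>\<^bsub>V\<^esub>"
    and \<delta>_\<pi>: "\<delta> \<pi> \<ominus>\<^bsub>V\<^esub> \<one>\<^bsub>V\<^esub> \<in> I\<^sub>1"
    and \<delta>_add: "\<And>v w. v \<in> carrier V \<Longrightarrow> w \<in> carrier V \<Longrightarrow>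
      \<delta> (v \<oplus>\<^bsub>V\<^esub> w) \<ominus>\<^bsub>V\<^esub> (\<delta> v \<oplus>\<^bsub>V\<^esub> \<delta> w) \<in> I\<^sub>1"
    and \<delta>_mult: "\<And>v w. v \<in> carrier V \<Longrightarrow> w \<in> carrier V \<Longrightarrow>
      \<delta> (v \<otimes>\<^bsub>V\<^esub> w) \<ominus>\<^bsub>V\<^esub> (v \<otimes>\<^bsub>V\<^esub> \<delta> w \<oplus>\<^bsub>V\<^esub> w \<otimes>\<^bsub>V\<^esub> \<delta> v) \<in> I\<^sub>1"
    using ex_derivation_mod_uniformizer by blast
  define S where "S = mpoly_ring V n"
  define J where "J = PIdl\<^bsub>S\<^esub> (indexed_const \<pi>)"
  have der: "Z_derivation S (quot_module S J) (\<lambda>P. J +>\<^bsub>S\<^esub> (\<delta> \<circ> P))"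
    unfolding S_def J_def
    by (rule Z_derivation_mpoly_coefficientwise[OF uniformizer_closed \<delta> \<delta>_add \<delta>_mult])
  \<comment> \<open>Away from the empty monomial this is the normalization of
    \<open>\<delta>\<close> at zero.\<close>
  have "\<delta> \<circ> indexed_const \<pi> = (indexed_const (\<delta> \<pi>) :: nat multiset \<Rightarrow> 'a)"
    using \<delta>(2) by (auto simp: indexed_const_def fun_eq_iff)
  moreover have "J +>\<^bsub>S\<^esub> indexed_const (\<delta> \<pi>) = J +>\<^bsub>S\<^esub> indexed_const \<one>\<^bsub>V\<^esub>"
    unfolding S_def J_def
  proof (rule rcos_mpoly_eqI[OF uniformizer_closed])
    have "\<delta> \<pi> \<in> carrier V" using \<delta> uniformizer_closed by auto
    then show "indexed_const (\<delta> \<pi>) \<in> carrier (mpoly_ring V n)"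
      "indexed_const \<one>\<^bsub>V\<^esub> \<in> carrier (mpoly_ring V n)"
      by (auto simp: mpoly_ring_simps intro: indexed_pset.indexed_const)
    show "indexed_const (\<delta> \<pi>) m \<ominus>\<^bsub>V\<^esub> indexed_const \<one>\<^bsub>V\<^esub> m \<in> I\<^sub>1" for m :: "nat multiset"
      using \<delta>_\<pi> I\<^sub>1.zero_closed by (simp add: indexed_const_def minus_eq)
  qed
  moreover have "\<one>\<^bsub>quot_module S J\<^esub> = J +>\<^bsub>S\<^esub> indexed_const \<one>\<^bsub>V\<^esub>"
    by (simp add: quot_module_def ring.defs FactRing_def S_def mpoly_ring_simps)
  ultimately show ?thesis
    unfolding Let_def S_def[symmetric] J_def[symmetric]
    by (intro exI[of _ "\<lambda>P. J +>\<^bsub>S\<^esub> (\<delta> \<circ> P)"] conjI der) simp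
qed

end
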